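(* Let $S_E$ and $\overline{S}_j$ satisfy the standard conditions and suppose that the matrices $\partial F_E(x,\lambda_E)/\partial x$ and $\partial F_j(x,\lambda_j)/\partial x$ have full column rank for all $x\in\mathbb{R}^N$, $\lambda_E\in\mathbb{R}^{M_E}$, $\lambda_j\in\mathbb{R}^{M_j}$. If $S_E(\lambda_E)\cap\overline{S}_j(\lambda_j)=\emptyset$, then $d_\epsilon^+$ is differentiable with respect to $\theta=(\lambda_E,\lambda_j)$.
   Context: For $\epsilon>0$ and $x\in\mathbb{R}^q$, $\mathrm{LSE}_\epsilon^+(x)=\frac1\epsilon\log\left(1+\sum_{i=1}^q e^{\epsilon x_i}\right)$. Fix $\epsilon>0$. Standard conditions. A set-valued map $S':\mathbb{R}^{M'}\to2^{\mathbb{R}^N}$ satisfies the standard conditions if: (1) $S'(\lambda')$ is convex, compact and has nonempty interior for all $\lambda'\in\mathbb{R}^{M'}$; (2) there are functions $F^k:\mathbb{R}^N\times\mathbb{R}^{M'}\to\mathbb{R}$, $k=1,\dots,n_F$, $n_F\ge1$, convex in their first argument $x$ and parameterized by $\lambda'$, with $S'(\lambda')=\{x:F^k(x,\lambda')\le0\ \forall k=1,\dots,n_F\}$; (3) the functions $\partial F^k/\partial x$ are continuously differentiable in $\lambda'$ and twice continuously differentiable in $x$. For the set-valued maps $S_E:\mathbb{R}^{M_E}\to2^{\mathbb{R}^N}$ and $\overline{S}_j:\mathbb{R}^{M_j}\to2^{\mathbb{R}^N}$, the associated vectors of convex functions are $F_E=(F_E^1,\dots,F_E^{n_{F_E}})$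 and $F_j=(F_j^1,\dots,F_j^{n_{F_j}})$. Overapproximations: $(S_E)_\epsilon^+(\lambda_E)=\{x:\mathrm{LSE}_\epsilon^+(F_E(x,\lambda_E))\le\frac{\log(n_{F_E})}{\epsilon}\}$ and $(\overline{S}_j)_\epsilon^+(\lambda_j)=\{x:\mathrm{LSE}_\epsilon^+(F_j(x,\lambda_j))\le\frac{\log(n_{F_j})}{\epsilon}\}$. The approximate squared distance function is $$d_\epsilon^+(\lambda_E,\lambda_j)=\min\left\{\tfrac12\|z_E-z_j\|_2^2:\ z_E\in(S_E)_\epsilon^+(\lambda_E),\ z_j\in(\overline{S}_j)_\epsilon^+(\lambda_j)\right\}.$$
   Formalization: The formal theorem additionally assumes that, for each x, F_E and F_j are differentiable in their parameters at λ_E, λ_j, and that the overapproximations of S_E(λ_E) and S_j(λ_j) have nonempty interior; without either assumption the claim is false. *)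

theory Defs
  imports "HOL-Analysis.Analysis"
begin

definition cont_diff :: "('a::real_normed_vector \<Rightarrow> 'b::real_normed_vector) \<Rightarrow> bool" where
  "cont_diff f \<longleftrightarrow>
     (\<exists>f' :: 'a \<Rightarrow> 'a \<Rightarrow>\<^sub>L 'b.
        (\<forall>x. (f has_derivative blinfun_apply (f' x)) (at x)) \<and> continuous_on UNIV f')"

definition twice_cont_diff :: "('a::real_normed_vector \<Rightarrow> 'b::real_normed_vector) \<Rightarrow> bool" where
  "twice_cont_diff f \<longleftrightarrow>
     (\<exists>f' :: 'a \<Rightarrow> 'a \<Rightarrow>\<^sub>L 'b.
        (\<forall>x. (f has_derivative blinfun_apply (f' x)) (at x)) \<and> cont_diff f')"

text \<open>The functions \<open>F\<^sup>1, \<dots>, F\<^sup>n\<close> are the components of one vector-valued function \<open>F x l\<close>; their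
  number is the cardinality of the index type, hence at least 1.\<close>

definition jac_x ::
  "(real^'n \<Rightarrow> real^'m \<Rightarrow> real^'k) \<Rightarrow> real^'n \<Rightarrow> real^'m \<Rightarrow> real^'n^'k" where
  "jac_x F x l = jacobian (\<lambda>y. F y l) (at x)"

text \<open>Row \<open>k\<close> of \<^const>\<open>jac_x\<close> is the derivative of \<open>F\<^sup>k\<close> with respect to \<open>x\<close>; it is
  meaningful because differentiability in \<open>x\<close> is required explicitly. The smoothness in \<open>l\<close> and the
  smoothness in \<open>x\<close> are each required with the other variable held fixed, which is weaker than
  asking for derivatives that are jointly continuous.\<close>

definition standard_conditions ::
  "(real^'m \<Rightarrow> (real^'n) set) \<Rightarrow> (real^'n \<Rightarrow> real^'m \<Rightarrow> real^'k) \<Rightarrow> bool" where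
  "standard_conditions S F \<longleftrightarrow>
     (\<forall>l. convex (S l) \<and> compact (S l) \<and> interior (S l) \<noteq> {}) \<and>
     (\<forall>l k. convex_on UNIV (\<lambda>x. F x l $ k)) \<and>
     (\<forall>l. S l = {x. \<forall>k. F x l $ k \<le> 0}) \<and>
     (\<forall>l x. (\<lambda>y. F y l) differentiable (at x)) \<and>
     (\<forall>x k. cont_diff (\<lambda>l. row k (jac_x F x l))) \<and>
     (\<forall>l k. twice_cont_diff (\<lambda>x. row k (jac_x F x l)))"

definition LSE_plus :: "real \<Rightarrow> real^'q \<Rightarrow> real" where
  "LSE_plus \<epsilon> x = 1 / \<epsilon> * ln (1 + (\<Sum>i\<in>UNIV. exp (\<epsilon> * x $ i)))"

text \<open>With \<open>n\<close> components the condition reads \<open>(\<Sum>i. exp (\<epsilon> * F\<^sup>i)) \<le> n - 1\<close>. The set can be empty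
  or a single point even if \<open>{x. \<forall>i. F\<^sup>i \<le> 0}\<close> has nonempty interior.\<close>

definition overapprox ::
  "real \<Rightarrow> (real^'n \<Rightarrow> real^'m \<Rightarrow> real^'k) \<Rightarrow> real^'m \<Rightarrow> (real^'n) set" where
  "overapprox \<epsilon> F l = {x. LSE_plus \<epsilon> (F x l) \<le> ln (real CARD('k)) / \<epsilon>}"

text \<open>A minimum, not an infimum: the value is unspecified if no minimum exists.\<close>

definition approx_sqdist ::
  "real \<Rightarrow> (real^'n \<Rightarrow> real^'a \<Rightarrow> real^'k) \<Rightarrow> (real^'n \<Rightarrow> real^'b \<Rightarrow> real^'h) \<Rightarrow>
     real^'a \<Rightarrow> real^'b \<Rightarrow> real" where
  "approx_sqdist \<epsilon> F G l m =
     (LEAST v. v \<in> {1/2 * (norm (z - w))\<^sup>2 | z w. z \<in> overapprox \<epsilon> F l \<and> w \<in> overapprox \<epsilon> G m})"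

end

theory Submission
  imports Defs
begin

text \<open>
  Each overapproximation is the sublevel set \<open>{x. g x l \<le> 0}\<close> of one scalar function,
  \<open>g x l = (\<Sum>k. exp (\<epsilon> * F\<^sup>k x l)) - (n - 1)\<close>. It is convex in \<open>x\<close>, and the full column rank of the
  Jacobian gives strict midpoint convexity: if no exponential gains strictly at the midpoint of a
  segment, then every \<open>F\<^sup>k\<close> takes equal values at both ends and at the midpoint, so the direction of
  the segment is in the kernel of the Jacobian there. Hence the set at the base parameter has a
  Slater point as soon as it has interior points, and it inherits boundedness from \<open>S l\<close>.

  The rest is an envelope theorem. Let \<open>(x\<^sup>*, y\<^sup>*)\<close> be a closest pair at \<open>(l0, m0)\<close>. The vector
  \<open>y\<^sup>* - x\<^sup>*\<close> is normal to both sets, so it is \<open>c *\<^sub>R \<nabla>g\<close> and \<open>- k *\<^sub>R \<nabla>h\<close> with multipliers \<open>c, k \<ge> 0\<close>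
  that vanish at inactive constraints. The derivative of the value function is then
  \<open>c * \<partial>g/\<partial>l + k * \<partial>h/\<partial>m\<close>, and expanding the cost at \<open>(x\<^sup>*, y\<^sup>*)\<close> reduces the claim to first order
  control of \<open>\<nabla>g \<bullet> (x - x\<^sup>*)\<close> over feasible points \<open>x\<close>, in two directions.

  \<^item> Upper bound (\<open>val_upper_bound\<close>): some feasible \<open>x\<close> at distance \<open>O(\<bar>l - l0\<bar>)\<close> has
    \<open>\<nabla>g \<bullet> (x - x\<^sup>*) \<ge> - \<partial>g/\<partial>l (l - l0) - o(\<bar>l - l0\<bar>)\<close>.
    It lies on the line through \<open>x\<^sup>*\<close> in direction \<open>\<nabla>g\<close>.
  \<^item> Lower bound: every feasible \<open>x\<close> near \<open>x\<^sup>*\<close> satisfies the opposite inequality. It applies to the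
    minimizers because they converge to \<open>(x\<^sup>*, y\<^sup>*)\<close> when the distance is positive, where the closest
    pair is unique by strict midpoint convexity. At distance zero the multipliers vanish, and the
    bound is the nonnegativity of the cost.

  The value and the gradient of \<open>g\<close> depend smoothly on \<open>l\<close> for each fixed \<open>x\<close>, with no uniformity
  in \<open>x\<close>. Convexity in \<open>x\<close> supplies it: chords through finitely many fixed points bound \<open>g (\<cdot>) l\<close> from
  above, the tangent at a fixed point bounds it from below, and only the fixed points are
  compared at different parameters.
\<close>

section \<open>Convex functions, compactness and first order expansions\<close>

text \<open>
  The inequality is one-dimensional: it is the tangent inequality of the restriction of \<open>f\<close> to the
  line through \<open>x\<close> and \<open>y\<close>.
\<close>

lemma convex_on_above_derivative:
  fixes f :: "'a::real_normed_vector \<Rightarrow> real"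
  assumes cvx: "convex_on UNIV f" and deriv: "(f has_derivative f') (at x)"
  shows "f x + f' (y - x) \<le> f y"
proof -
  define \<phi> where "\<phi> = (\<lambda>t::real. f (x + t *\<^sub>R (y - x)))"
  have "convex_on UNIV \<phi>"
  proof (rule convex_onI)
    fix t a b :: real assume t: "0 < t" "t < 1"
    have "x + ((1 - t) *\<^sub>R a + t *\<^sub>R b) *\<^sub>R (y - x)
        = (1 - t) *\<^sub>R (x + a *\<^sub>R (y - x)) + t *\<^sub>R (x + b *\<^sub>R (y - x))"
      by (simp add: algebra_simps)
    then show "\<phi> ((1 - t) *\<^sub>R a + t *\<^sub>R b) \<le> (1 - t) * \<phi> a + t * \<phi> b"
      unfolding \<phi>_def using convex_onD[OF cvx, of t] t by simp
  qed simp
  moreover have "(\<phi> has_derivative (\<lambda>t. f' (t *\<^sub>R (y - x)))) (at 0)"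
    unfolding \<phi>_def
    by (rule has_derivative_compose[where f="\<lambda>t. x + t *\<^sub>R (y - x)"])
       (auto intro!: derivative_eq_intros simp: deriv)
  then have "(\<phi> has_field_derivative f' (y - x)) (at 0)"
    unfolding has_field_derivative_def
    using linear_cmul[OF has_derivative_linear[OF deriv]]
    by (simp add: mult_commute_abs)
  ultimately have "\<phi> 1 - \<phi> 0 \<ge> f' (y - x) * (1 - 0)"
    by (intro convex_on_imp_above_tangent[where A=UNIV]) auto
  then show ?thesis by (simp add: \<phi>_def)
qed

lemma convex_on_subgradient:
  fixes f :: "'a::real_inner \<Rightarrow> real"
  assumes "\<And>x y. f x + d x \<bullet> (y - x) \<le> f y"
  shows "convex_on UNIV f"
proof (rule convex_onI)
  fix t :: real and x y :: 'a assume t: "0 < t" "t < 1"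
  define z where "z = (1 - t) *\<^sub>R x + t *\<^sub>R y"
  have "(1 - t) * (f z + d z \<bullet> (x - z)) + t * (f z + d z \<bullet> (y - z))
      = f z + d z \<bullet> ((1 - t) *\<^sub>R (x - z) + t *\<^sub>R (y - z))"
    by (simp add: algebra_simps)
  also have "(1 - t) *\<^sub>R (x - z) + t *\<^sub>R (y - z) = 0"
    by (simp add: z_def algebra_simps)
  finally have "f z = (1 - t) * (f z + d z \<bullet> (x - z)) + t * (f z + d z \<bullet> (y - z))" by simp
  also have "\<dots> \<le> (1 - t) * f x + t * f y"
    using t assms by (intro add_mono mult_left_mono) auto
  finally show "f ((1 - t) *\<^sub>R x + t *\<^sub>R y) \<le> (1 - t) * f x + t * f y" by (simp add: z_def)
qed simp

text \<open>
  A bound on a sphere around a point where \<open>f\<close> is nonpositive controls \<open>f\<close> outside that sphere: \<open>f\<close>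
  grows at least linearly along rays once it is positive. The point \<open>b\<close> is the radial projection of
  \<open>x\<close>.
\<close>

lemma convex_on_sphere_le:
  fixes f :: "'a::real_normed_vector \<Rightarrow> real"
  assumes cvx: "convex_on UNIV f" and p: "f p \<le> 0" and R: "0 < R" "R \<le> norm (x - p)"
  obtains b where "b \<in> sphere p R" "f b \<le> R / norm (x - p) * f x"
proof
  define t where "t = R / norm (x - p)"
  have "norm (x - p) > 0" using R by linarith
  then have t: "0 < t" "t \<le> 1" using R by (auto simp: t_def)
  define b where "b = (1 - t) *\<^sub>R p + t *\<^sub>R x"
  have "b - p = t *\<^sub>R (x - p)" by (simp add: b_def algebra_simps)
  then have "norm (b - p) = R" using R by (auto simp: t_def)
  then show "b \<in> sphere p R" by (simp add: dist_norm norm_minus_commute)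
  have "f b \<le> (1 - t) * f p + t * f x"
    unfolding b_def using t by (intro convex_onD[OF cvx]) auto
  also have "\<dots> \<le> t * f x" using t p by (simp add: mult_nonneg_nonpos)
  finally show "f b \<le> R / norm (x - p) * f x" by (simp add: t_def)
qed

text \<open>
  On a sphere that encloses the zero sublevel set, \<open>f\<close> has a positive minimum, so it grows at least
  linearly outside.
\<close>

lemma bounded_sublevel_convex:
  fixes f :: "'a::euclidean_space \<Rightarrow> real"
  assumes cvx: "convex_on UNIV f" and bdd: "bounded {x. f x \<le> 0}" and p: "f p \<le> 0"
  shows "bounded {x. f x \<le> c}"
proof -
  obtain R where R: "0 < R" "{x. f x \<le> 0} \<subseteq> ball p R"
    using bounded_subset_ballD[OF bdd] by blast
  have "continuous_on (sphere p R) f"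
    using convex_on_continuous[OF open_UNIV cvx] continuous_on_subset by blast
  then obtain q where q: "q \<in> sphere p R" "\<And>b. b \<in> sphere p R \<Longrightarrow> f q \<le> f b"
    using continuous_attains_inf[OF compact_sphere, of p R f] R by auto
  have fq: "f q > 0" using q(1) R(2) by (force simp: not_le[symmetric])
  have "norm (x - p) \<le> max R (R * c / f q)" if "f x \<le> c" for x
  proof (cases "R \<le> norm (x - p)")
    case True
    then obtain b where b: "b \<in> sphere p R" "f b \<le> R / norm (x - p) * f x"
      using convex_on_sphere_le[OF cvx p R(1)] by blast
    have "f q \<le> R / norm (x - p) * c"
      using b q(2)[OF b(1)] mult_left_mono[OF that, of "R / norm (x - p)"] R by simp
    moreover have "norm (x - p) > 0" using True R by linarith
    ultimately have "norm (x - p) \<le> R * c / f q"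
      using fq by (simp add: field_simps)
    then show ?thesis by simp
  qed auto
  then have "{x. f x \<le> c} \<subseteq> cball p (max R (R * c / f q))"
    by (auto simp: dist_norm norm_minus_commute)
  then show ?thesis using bounded_cball bounded_subset by blast
qed

text \<open>
  The tube lemma in terms of filters: a property that holds near each \<open>(l0, q)\<close> with \<open>q\<close> in a
  compact set holds for all parameters near \<open>l0\<close>, uniformly over that set.
\<close>

lemma eventually_ball_compact:
  assumes "compact K"
    and "\<And>q. q \<in> K \<Longrightarrow> \<forall>\<^sub>F (l, x) in nhds (l0, q). P l x"
  shows "\<forall>\<^sub>F l in nhds l0. \<forall>x\<in>K. P l x"
proof -
  define W where "W = interior {(l, x). P l x}"
  have "{l0} \<times> K \<subseteq> W"
    using assms(2) by (force simp: W_def eventually_nhds interior_def)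
  then obtain X0 where "l0 \<in> X0" "open X0" "X0 \<times> K \<subseteq> W"
    using Elementary_Topology.tube_lemma[OF assms(1), of W l0] by (auto simp: W_def)
  moreover have "W \<subseteq> {(l, x). P l x}" by (simp add: W_def interior_subset)
  ultimately show ?thesis unfolding eventually_nhds by blast
qed

lemma has_derivative_eventually_le:
  assumes "(f has_derivative A) (at a)" "0 < e"
  shows "\<forall>\<^sub>F x in nhds a. norm (f x - f a - A (x - a)) \<le> e * norm (x - a)"
proof -
  obtain d where "0 < d" "\<And>y. norm (y - a) < d \<Longrightarrow> norm (f y - f a - A (y - a)) \<le> e * norm (y - a)"
    using assms unfolding has_derivative_at_alt by blast
  then show ?thesis unfolding eventually_nhds_metric dist_norm by blast
qed

lemma convex_sublevel:
  assumes f: "convex_on UNIV f" shows "convex {x. f x \<le> c}"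
proof (rule convexI)
  fix x y and u v :: real
  assume *: "x \<in> {x. f x \<le> c}" "y \<in> {x. f x \<le> c}" "0 \<le> u" "0 \<le> v" "u + v = 1"
  then have "f (u *\<^sub>R x + v *\<^sub>R y) \<le> u * f x + v * f y"
    using f by (simp add: convex_on_def)
  also have "\<dots> \<le> c" using * by (intro convex_bound_le) auto
  finally show "u *\<^sub>R x + v *\<^sub>R y \<in> {x. f x \<le> c}" by simp
qed

lemma half_sqnorm_expansion:
  fixes x y :: "'a::real_inner"
  shows "1/2 * (norm (x - y))\<^sup>2 = 1/2 * (norm (xs - ys))\<^sup>2 - (ys - xs) \<bullet> (x - xs)
      - (xs - ys) \<bullet> (y - ys) + 1/2 * (norm ((x - xs) - (y - ys)))\<^sup>2"
  unfolding power2_norm_eq_inner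
  by (simp add: algebra_simps inner_commute)

lemma eventually_nhds_fst:
  assumes "\<forall>\<^sub>F l in nhds a. P l" shows "\<forall>\<^sub>F \<theta> in nhds (a, b). P (fst \<theta>)"
proof -
  have "filterlim fst (nhds a) (nhds (a, b))"
    using tendsto_fst[OF filterlim_ident, of "(a, b)"] by simp
  then show ?thesis using assms by (rule eventually_compose_filterlim[rotated])
qed

lemma eventually_nhds_snd:
  assumes "\<forall>\<^sub>F m in nhds b. P m" shows "\<forall>\<^sub>F \<theta> in nhds (a, b). P (snd \<theta>)"
proof -
  have "filterlim snd (nhds b) (nhds (a, b))"
    using tendsto_snd[OF filterlim_ident, of "(a, b)"] by simp
  then show ?thesis using assms by (rule eventually_compose_filterlim[rotated])
qed

lemma bounded_linear_multipliers:
  assumes "bounded_linear A" "bounded_linear B"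
  shows "bounded_linear (\<lambda>\<theta>. c * A (fst \<theta>) + k * B (snd \<theta>) :: real)"
  by (intro bounded_linear_add bounded_linear_const_mult
      bounded_linear_compose[OF assms(1) bounded_linear_fst]
      bounded_linear_compose[OF assms(2) bounded_linear_snd])

section \<open>A convex constraint that depends on a parameter\<close>

text \<open>
  Smooth dependence on the parameter is pointwise: it is a property at \<open>l0\<close> of each fixed point \<open>x\<close>.
  The subgradient inequality holds at every parameter; it is what carries information about fixed
  points over to their neighbours.
\<close>

locale convex_constraint =
  fixes g :: "'a::euclidean_space \<Rightarrow> 'l::real_normed_vector \<Rightarrow> real"
    and D :: "'a \<Rightarrow> 'l \<Rightarrow> 'a"
    and l0 :: 'l
  assumes subgradient: "g x l + D x l \<bullet> (y - x) \<le> g y l"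
    and gradient: "((\<lambda>x. g x l0) has_derivative (\<lambda>h. D x l0 \<bullet> h)) (at x)"
    and value_differentiable: "g x differentiable (at l0)"
    and gradient_differentiable: "D x differentiable (at l0)"
    and Slater: "\<exists>p. g p l0 < 0"
    and bounded_feasible: "bounded {x. g x l0 \<le> 0}"
    and strict_midpoint: "\<lbrakk>x \<noteq> y; g x l0 \<le> 0; g y l0 \<le> 0\<rbrakk> \<Longrightarrow> g (midpoint x y) l0 < 0"
begin

lemma convex: "convex_on UNIV (\<lambda>x. g x l)"
  by (rule convex_on_subgradient[where d="\<lambda>x. D x l"]) (rule subgradient)

lemma continuous: "continuous_on UNIV (\<lambda>x. g x l)"
  by (rule convex_on_continuous[OF open_UNIV convex])

lemma closed_feasible: "closed {x. g x l \<le> 0}"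
  by (intro closed_Collect_le continuous continuous_on_const)

lemma value_tendsto: "(g x \<longlongrightarrow> g x l0) (nhds l0)"
  using differentiable_imp_continuous_within[OF value_differentiable]
  by (simp add: isCont_def tendsto_at_iff_tendsto_nhds)

lemma gradient_tendsto: "(D x \<longlongrightarrow> D x l0) (nhds l0)"
  using differentiable_imp_continuous_within[OF gradient_differentiable]
  by (simp add: isCont_def tendsto_at_iff_tendsto_nhds)

text \<open>
  Lower semicontinuity of \<open>g\<close> at \<open>(l0, q)\<close> jointly in both variables: the tangent at the fixed point
  \<open>q\<close> is a lower bound of \<open>g\<close> that is jointly continuous.
\<close>

lemma infeasible_nearby:
  assumes "g q l0 > 0"
  shows "\<forall>\<^sub>F (l, x) in nhds (l0, q). g x l > 0"
proof -
  have fst: "filterlim fst (nhds l0) (nhds (l0, q))"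
    using tendsto_fst[OF filterlim_ident, of "(l0,q)"] by (simp add: id_def)
  have snd: "(snd \<longlongrightarrow> q) (nhds (l0, q))"
    using tendsto_snd[OF filterlim_ident, of "(l0,q)"] by (simp add: id_def)
  have "((\<lambda>z. g q (fst z) + D q (fst z) \<bullet> (snd z - q)) \<longlongrightarrow> g q l0 + D q l0 \<bullet> (q - q)) (nhds (l0, q))"
    by (intro tendsto_intros snd filterlim_compose[OF value_tendsto fst]
        filterlim_compose[OF gradient_tendsto fst])
  then have "\<forall>\<^sub>F z in nhds (l0, q). 0 < g q (fst z) + D q (fst z) \<bullet> (snd z - q)"
    using assms by (intro order_tendstoD(1)) auto
  then show ?thesis
    by eventually_elim (use subgradient in \<open>force simp: case_prod_beta intro: less_le_trans\<close>)
qed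

text \<open>
  A sphere around a Slater point that encloses the feasible set at \<open>l0\<close> stays infeasible for nearby
  parameters. By convexity, everything outside it is infeasible as well.
\<close>

lemma uniformly_bounded_feasible:
  obtains R where "\<forall>\<^sub>F l in nhds l0. {x. g x l \<le> 0} \<subseteq> cball 0 R"
proof -
  obtain p where p: "g p l0 < 0" using Slater by blast
  obtain R where R: "0 < R" "{x. g x l0 \<le> 0} \<subseteq> ball p R"
    using bounded_subset_ballD[OF bounded_feasible] by blast
  have "\<forall>\<^sub>F l in nhds l0. \<forall>x\<in>sphere p R. g x l > 0"
    by (rule eventually_ball_compact[OF compact_sphere], rule infeasible_nearby)
       (use R in \<open>force simp: not_le[symmetric]\<close>)
  moreover have "\<forall>\<^sub>F l in nhds l0. g p l < 0"
    using order_tendstoD(2)[OF value_tendsto p] .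
  ultimately have "\<forall>\<^sub>F l in nhds l0. {x. g x l \<le> 0} \<subseteq> cball 0 (norm p + R)"
  proof eventually_elim
    case (elim l)
    have "norm (x - p) \<le> R" if x: "g x l \<le> 0" for x
    proof (rule ccontr)
      assume "\<not> norm (x - p) \<le> R"
      then obtain b where b: "b \<in> sphere p R" "g b l \<le> R / norm (x - p) * g x l"
        using convex_on_sphere_le[OF convex, of p l R x] elim(2) R by auto
      have "R / norm (x - p) * g x l \<le> 0"
        using R x by (intro mult_nonneg_nonpos) auto
      then show False using b elim(1) by fastforce
    qed
    then have "norm x \<le> norm p + R" if "g x l \<le> 0" for x
      using norm_triangle_sub[of x p] that by fastforce
    then show ?case by auto
  qed
  then show thesis by (rule that)
qed

text \<open>
  With zero gradient the value 0 would be a global minimum, against the Slater point.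
\<close>

lemma active_gradient_nonzero:
  assumes "g xs l0 = 0" shows "D xs l0 \<noteq> 0"
  using Slater subgradient[of xs l0] assms by (metis add.right_neutral inner_zero_left not_le)

text \<open>
  A first order upper bound along a ray that is uniform in the parameter. Difference quotients of a
  convex function increase with the step, so the quotient over the whole of \<open>[0, T]\<close> bounds all
  others, and it involves \<open>g\<close> at two fixed points only.
\<close>

lemma directional_upper_bound:
  assumes "0 < \<eta>"
  obtains T where "0 < T"
    "\<forall>\<^sub>F l in nhds l0. \<forall>s\<in>{0..T}. g (xs + s *\<^sub>R w) l \<le> g xs l + s * (D xs l0 \<bullet> w + \<eta>)"
proof -
  have "((\<lambda>t. g (xs + t *\<^sub>R w) l0) has_derivative (\<lambda>t. D xs l0 \<bullet> (t *\<^sub>R w))) (at 0)"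
    by (rule has_derivative_compose[where f="\<lambda>t. xs + t *\<^sub>R w"])
       (auto intro!: derivative_eq_intros simp: gradient)
  then have "((\<lambda>t. g (xs + t *\<^sub>R w) l0) has_field_derivative D xs l0 \<bullet> w) (at 0)"
    by (simp add: has_field_derivative_def mult_commute_abs)
  then have "(\<lambda>t. (g (xs + t *\<^sub>R w) l0 - g xs l0) / t) \<midarrow>0\<rightarrow> D xs l0 \<bullet> w"
    by (simp add: DERIV_def)
  then have "\<forall>\<^sub>F t in at_right 0. (g (xs + t *\<^sub>R w) l0 - g xs l0) / t < D xs l0 \<bullet> w + \<eta>"
    using assms by (intro order_tendstoD(2)[of _ "D xs l0 \<bullet> w"])
      (auto intro: tendsto_mono[OF at_le])
  then have "\<forall>\<^sub>F t in at_right 0. 0 < t \<and> (g (xs + t *\<^sub>R w) l0 - g xs l0) / t < D xs l0 \<bullet> w + \<eta>"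
    by (simp add: eventually_conj_iff eventually_at_right_less)
  then obtain T where T: "0 < T" "(g (xs + T *\<^sub>R w) l0 - g xs l0) / T < D xs l0 \<bullet> w + \<eta>"
    by (auto dest: eventually_happens)
  have "\<forall>\<^sub>F l in nhds l0. (g (xs + T *\<^sub>R w) l - g xs l) / T < D xs l0 \<bullet> w + \<eta>"
    using T by (intro order_tendstoD(2)[OF _ T(2)] tendsto_intros value_tendsto) auto
  then have "\<forall>\<^sub>F l in nhds l0. \<forall>s\<in>{0..T}. g (xs + s *\<^sub>R w) l \<le> g xs l + s * (D xs l0 \<bullet> w + \<eta>)"
  proof eventually_elim
    case (elim l)
    show ?case
    proof
      fix s assume s: "s \<in> {0..T}"
      have "xs + s *\<^sub>R w = (1 - s / T) *\<^sub>R xs + (s / T) *\<^sub>R (xs + T *\<^sub>R w)"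
        using T by (simp add: algebra_simps)
      then have "g (xs + s *\<^sub>R w) l \<le> (1 - s / T) * g xs l + (s / T) * g (xs + T *\<^sub>R w) l"
        using s T convex_onD[OF convex, of "s / T" xs "xs + T *\<^sub>R w" l] by simp
      also have "\<dots> = g xs l + s * ((g (xs + T *\<^sub>R w) l - g xs l) / T)"
        using T by (simp add: field_simps)
      also have "\<dots> \<le> g xs l + s * (D xs l0 \<bullet> w + \<eta>)"
        using elim s by (intro add_left_mono mult_left_mono) auto
      finally show "g (xs + s *\<^sub>R w) l \<le> g xs l + s * (D xs l0 \<bullet> w + \<eta>)" .
    qed
  qed
  then show thesis using that T by blast
qed

text \<open>
  Feasibility of \<open>xs\<close> is lost at first order when \<open>l\<close> moves. It is restored by a step
  \<open>- s *\<^sub>R e\<close> along the gradient, where \<open>e\<close> is scaled such that \<open>D xs l0 \<bullet> e = 1\<close> and \<open>s\<close> is the first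
  order change of \<open>g xs\<close> plus a safety margin \<open>\<delta> * norm (l - l0)\<close>. The constant \<open>K\<close> is the
  same for all \<open>\<delta>\<close>, hence the margin can be made arbitrarily small later.
\<close>

lemma active_constraint_correction:
  assumes act: "g xs l0 = 0" and A: "(g xs has_derivative A) (at l0)"
  obtains K where "0 \<le> K"
    "\<And>\<delta>. \<lbrakk>0 < \<delta>; \<delta> \<le> 1\<rbrakk> \<Longrightarrow> \<forall>\<^sub>F l in nhds l0. \<exists>x. g x l \<le> 0 \<and> norm (x - xs) \<le> K * norm (l - l0)
        \<and> - A (l - l0) - \<delta> * norm (l - l0) \<le> D xs l0 \<bullet> (x - xs)"
proof -
  define e where "e = D xs l0 /\<^sub>R (D xs l0 \<bullet> D xs l0)"
  have e: "D xs l0 \<bullet> e = 1" using active_gradient_nonzero[OF act] by (simp add: e_def)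
  obtain M where M: "0 < M" "\<And>h. \<bar>A h\<bar> \<le> M * norm h"
    using bounded_linear.pos_bounded[OF has_derivative_bounded_linear[OF A]]
    by (auto simp: mult.commute)
  have main: "\<forall>\<^sub>F l in nhds l0. \<exists>x. g x l \<le> 0 \<and> norm (x - xs) \<le> (M + 1) * norm e * norm (l - l0)
        \<and> - A (l - l0) - \<delta> * norm (l - l0) \<le> D xs l0 \<bullet> (x - xs)"
    if \<delta>: "0 < \<delta>" "\<delta> \<le> 1" for \<delta>
  proof -
    \<comment> \<open>two kinds of error use up the margin: \<open>\<eta> * norm (l - l0)\<close> from linearizing \<open>g xs\<close>,
        and \<open>\<eta> * \<bar>s\<bar>\<close> with \<open>\<bar>s\<bar> \<le> (M + 1) * norm (l - l0)\<close> from the step\<close>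
    define \<eta> where "\<eta> = \<delta> / (M + 2)"
    have \<eta>: "0 < \<eta>" "\<eta> * (M + 2) = \<delta>" using \<delta> M by (auto simp: \<eta>_def)
    obtain T1 where T1: "0 < T1"
      "\<forall>\<^sub>F l in nhds l0. \<forall>s\<in>{0..T1}. g (xs + s *\<^sub>R e) l \<le> g xs l + s * (1 + \<eta>)"
      using directional_upper_bound[OF \<eta>(1), of xs e] unfolding e by blast
    obtain T2 where T2: "0 < T2"
      "\<forall>\<^sub>F l in nhds l0. \<forall>s\<in>{0..T2}. g (xs + s *\<^sub>R (- e)) l \<le> g xs l + s * (- 1 + \<eta>)"
      using directional_upper_bound[OF \<eta>(1), of xs "- e"] unfolding inner_minus_right e by blast
    have near: "\<forall>\<^sub>F l in nhds l0. dist l l0 < min T1 T2 / (M + 1)"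
      using T1 T2 M by (intro eventually_nhds_metric[THEN iffD2]) (auto intro!: exI[of _ "min T1 T2 / (M + 1)"])
    have lin: "\<forall>\<^sub>F l in nhds l0. \<bar>g xs l - g xs l0 - A (l - l0)\<bar> \<le> \<eta> * norm (l - l0)"
      using has_derivative_eventually_le[OF A \<eta>(1)] by simp
    show ?thesis using T1(2) T2(2) near lin
    proof eventually_elim
      case (elim l)
      define n where "n = norm (l - l0)"
      define s where "s = A (l - l0) + \<delta> * n"
      have n: "0 \<le> n" "n * (M + 1) < min T1 T2"
        using elim(3) M by (auto simp: n_def dist_norm field_simps)
      have "0 \<le> \<delta> * n" "\<delta> * n \<le> n" using \<delta> n by (auto simp: mult_left_le_one_le)
      moreover have "\<bar>A (l - l0)\<bar> \<le> M * n" using M(2) by (simp add: n_def)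
      ultimately have "\<bar>s\<bar> \<le> M * n + n" unfolding s_def by linarith
      then have s: "\<bar>s\<bar> \<le> (M + 1) * n" by (simp add: algebra_simps)
      \<comment> \<open>the sign of \<open>s\<close> decides which of the two rays contains the corrected point\<close>
      have "g (xs - s *\<^sub>R e) l \<le> g xs l - s + \<eta> * \<bar>s\<bar>"
      proof (cases "0 \<le> s")
        case True
        then have "s \<in> {0..T2}" using s n by (auto simp: mult.commute)
        then show ?thesis using bspec[OF elim(2), of s] True by (simp add: algebra_simps)
      next
        case False
        then have "- s \<in> {0..T1}" using s n by (auto simp: mult.commute)
        then show ?thesis using bspec[OF elim(1), of "- s"] False by (simp add: algebra_simps)
      qed
      also have "\<dots> \<le> (A (l - l0) + \<eta> * n) - s + \<eta> * ((M + 1) * n)"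
        using elim(4) act \<eta> s by (intro add_mono diff_mono mult_left_mono) (auto simp: n_def)
      also have "\<dots> = (\<eta> * (M + 2) - \<delta>) * n" by (simp add: s_def algebra_simps)
      also have "\<dots> = 0" using \<eta> by simp
      finally have "g (xs - s *\<^sub>R e) l \<le> 0" .
      moreover have "norm (xs - s *\<^sub>R e - xs) \<le> (M + 1) * norm e * n"
        using mult_right_mono[OF s, of "norm e"] by (simp add: algebra_simps)
      moreover have "- A (l - l0) - \<delta> * n \<le> D xs l0 \<bullet> (xs - s *\<^sub>R e - xs)"
        using e by (simp add: s_def)
      ultimately show ?case unfolding n_def by blast
    qed
  qed
  show thesis
    by (rule that[of "(M + 1) * norm e"]) (use M main in auto)
qed

lemma feasible_correction:
  assumes feas: "g xs l0 \<le> 0" and A: "(g xs has_derivative A) (at l0)"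
  obtains K where "0 \<le> K"
    "\<And>\<delta>. \<lbrakk>0 < \<delta>; \<delta> \<le> 1\<rbrakk> \<Longrightarrow> \<forall>\<^sub>F l in nhds l0. \<exists>x. g x l \<le> 0 \<and> norm (x - xs) \<le> K * norm (l - l0)
        \<and> (g xs l0 = 0 \<longrightarrow> - A (l - l0) - \<delta> * norm (l - l0) \<le> D xs l0 \<bullet> (x - xs))"
proof (cases "g xs l0 = 0")
  case True
  obtain K where "0 \<le> K"
    "\<And>\<delta>. \<lbrakk>0 < \<delta>; \<delta> \<le> 1\<rbrakk> \<Longrightarrow> \<forall>\<^sub>F l in nhds l0. \<exists>x. g x l \<le> 0 \<and> norm (x - xs) \<le> K * norm (l - l0)
        \<and> - A (l - l0) - \<delta> * norm (l - l0) \<le> D xs l0 \<bullet> (x - xs)"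
    using active_constraint_correction[OF True A] by blast
  then show thesis using that[of K] by (simp add: True)
next
  case False
  then have "\<forall>\<^sub>F l in nhds l0. g xs l < 0"
    using feas by (intro order_tendstoD(2)[OF value_tendsto]) auto
  then have "\<forall>\<^sub>F l in nhds l0. \<exists>x. g x l \<le> 0 \<and> norm (x - xs) \<le> 0 * norm (l - l0)
        \<and> (g xs l0 = 0 \<longrightarrow> - A (l - l0) - \<delta> * norm (l - l0) \<le> D xs l0 \<bullet> (x - xs))" for \<delta>
    by eventually_elim (use False in \<open>auto intro!: exI[of _ xs]\<close>)
  then show thesis using that[of 0] by auto
qed

text \<open>
  The tangent at \<open>xs\<close> for the parameter \<open>l\<close> confines the feasible set to a half-space. Replacing its
  normal vector by the one at \<open>l0\<close> costs \<open>O(norm (l - l0)) * norm (x - xs)\<close>, which is why \<open>x\<close> has to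
  be close to \<open>xs\<close>.
\<close>

lemma feasible_first_order_bound:
  assumes act: "g xs l0 = 0" and A: "(g xs has_derivative A) (at l0)" and \<eta>: "0 < \<eta>"
  obtains r where "0 < r"
    "\<forall>\<^sub>F l in nhds l0. \<forall>x. g x l \<le> 0 \<longrightarrow> norm (x - xs) \<le> r \<longrightarrow>
        D xs l0 \<bullet> (x - xs) \<le> - A (l - l0) + \<eta> * norm (l - l0)"
proof -
  obtain B where B: "(D xs has_derivative B) (at l0)"
    using gradient_differentiable by (auto simp: differentiable_def)
  obtain M where M: "0 < M" "\<And>h. norm (B h) \<le> M * norm h"
    using bounded_linear.pos_bounded[OF has_derivative_bounded_linear[OF B]]
    by (auto simp: mult.commute)
  define r where "r = \<eta> / (2 * (M + 1))"
  have r: "0 < r" "(M + 1) * r = \<eta> / 2" using M \<eta> by (auto simp: r_def field_simps)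
  have lin: "\<forall>\<^sub>F l in nhds l0. \<bar>g xs l - g xs l0 - A (l - l0)\<bar> \<le> \<eta> / 2 * norm (l - l0)"
    using has_derivative_eventually_le[OF A half_gt_zero[OF \<eta>]] by simp
  have lip: "\<forall>\<^sub>F l in nhds l0. norm (D xs l - D xs l0 - B (l - l0)) \<le> 1 * norm (l - l0)"
    by (rule has_derivative_eventually_le[OF B zero_less_one])
  have "\<forall>\<^sub>F l in nhds l0. \<forall>x. g x l \<le> 0 \<longrightarrow> norm (x - xs) \<le> r \<longrightarrow>
        D xs l0 \<bullet> (x - xs) \<le> - A (l - l0) + \<eta> * norm (l - l0)"
    using lin lip
  proof eventually_elim
    case (elim l)
    show ?case
    proof (intro allI impI)
      fix x assume x: "g x l \<le> 0" "norm (x - xs) \<le> r"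
      define n where "n = norm (l - l0)"
      have "norm (D xs l - D xs l0) \<le> (M + 1) * n"
        using elim(2) M(2)[of "l - l0"] norm_triangle_sub[of "D xs l - D xs l0" "B (l - l0)"]
        by (simp add: n_def algebra_simps)
      then have "norm (D xs l - D xs l0) * norm (x - xs) \<le> (M + 1) * n * r"
        using x M by (intro mult_mono) (auto simp: n_def)
      also have "\<dots> = \<eta> / 2 * n" using r by (metis mult.assoc mult.commute)
      finally have "- ((D xs l - D xs l0) \<bullet> (x - xs)) \<le> \<eta> / 2 * n"
        using Cauchy_Schwarz_ineq2[of "D xs l - D xs l0" "x - xs"] by linarith
      then have "D xs l0 \<bullet> (x - xs) \<le> D xs l \<bullet> (x - xs) + \<eta> / 2 * n"
        by (simp add: inner_diff_left)
      also have "D xs l \<bullet> (x - xs) \<le> - g xs l"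
        using subgradient[of xs l x] x by linarith
      also have "\<dots> \<le> - A (l - l0) + \<eta> / 2 * n"
      proof -
        have "\<bar>g xs l - A (l - l0)\<bar> \<le> \<eta> / 2 * n" using elim(1) act by (simp add: n_def)
        then show ?thesis by linarith
      qed
      finally show "D xs l0 \<bullet> (x - xs) \<le> - A (l - l0) + \<eta> * norm (l - l0)"
        by (simp add: n_def)
    qed
  qed
  then show thesis using that r by blast
qed

text \<open>
  Multiplying by \<open>c\<close> covers the inactive constraint: its multiplier vanishes.
\<close>

lemma multiplier_first_order_bound:
  assumes A: "(g xs has_derivative A) (at l0)" and c: "0 \<le> c" "c = 0 \<or> g xs l0 = 0" and e: "0 < e"
  obtains r where "0 < r"
    "\<forall>\<^sub>F l in nhds l0. \<forall>x. g x l \<le> 0 \<longrightarrow> norm (x - xs) \<le> r \<longrightarrow>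
        c * (D xs l0 \<bullet> (x - xs)) \<le> - (c * A (l - l0)) + e * norm (l - l0)"
proof (cases "c = 0")
  case True
  then show thesis using that[of 1] e by simp
next
  case False
  then have act: "g xs l0 = 0" and c': "0 < c" using c by auto
  obtain r where r: "0 < r" and ev: "\<forall>\<^sub>F l in nhds l0. \<forall>x. g x l \<le> 0 \<longrightarrow> norm (x - xs) \<le> r \<longrightarrow>
        D xs l0 \<bullet> (x - xs) \<le> - A (l - l0) + e / c * norm (l - l0)"
    using feasible_first_order_bound[OF act A, of "e / c"] e c' by auto
  have "\<forall>\<^sub>F l in nhds l0. \<forall>x. g x l \<le> 0 \<longrightarrow> norm (x - xs) \<le> r \<longrightarrow>
        c * (D xs l0 \<bullet> (x - xs)) \<le> - (c * A (l - l0)) + e * norm (l - l0)"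
    using ev
  proof eventually_elim
    case (elim l)
    show ?case
    proof (intro allI impI)
      fix x assume "g x l \<le> 0" "norm (x - xs) \<le> r"
      then have "D xs l0 \<bullet> (x - xs) \<le> - A (l - l0) + e / c * norm (l - l0)" using elim by blast
      from mult_left_mono[OF this c(1)]
      show "c * (D xs l0 \<bullet> (x - xs)) \<le> - (c * A (l - l0)) + e * norm (l - l0)"
        using c' by (simp add: algebra_simps)
    qed
  qed
  then show thesis using that r by blast
qed

text \<open>
  The normal cone of the feasible set at a boundary point is the ray spanned by the gradient: a
  normal vector has nonpositive inner product with each strict descent direction, in particular with
  those obtained by tilting its component orthogonal to the gradient slightly downwards. At an
  interior point all directions are admissible, and the normal vector vanishes.
\<close>

lemma normal_vector_multiplier:
  assumes feas: "g xs l0 \<le> 0"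
    and normal: "\<And>x. g x l0 \<le> 0 \<Longrightarrow> u \<bullet> (x - xs) \<le> 0"
  obtains c where "0 \<le> c" "u = c *\<^sub>R D xs l0" "c = 0 \<or> g xs l0 = 0"
proof -
  have dir: "u \<bullet> w \<le> 0" if w: "g xs l0 < 0 \<or> D xs l0 \<bullet> w < 0" for w
  proof -
    obtain t where t: "0 < t" "g (xs + t *\<^sub>R w) l0 \<le> 0"
    proof (cases "g xs l0 < 0")
      case True
      have "((\<lambda>t. g (xs + t *\<^sub>R w) l0) \<longlongrightarrow> g (xs + 0 *\<^sub>R w) l0) (at_right 0)"
        by (intro continuous_on_tendsto_compose[OF continuous] tendsto_intros) auto
      then have "\<forall>\<^sub>F t in at_right 0. g (xs + t *\<^sub>R w) l0 < 0"
        using True by (intro order_tendstoD(2)) auto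
      then have "\<forall>\<^sub>F t in at_right 0. 0 < t \<and> g (xs + t *\<^sub>R w) l0 < 0"
        by (simp add: eventually_conj_iff eventually_at_right_less)
      then show thesis using that by (force dest: eventually_happens)
    next
      case False
      then have w: "D xs l0 \<bullet> w < 0" using w by simp
      then obtain T where T: "0 < T" "\<forall>\<^sub>F l in nhds l0. \<forall>s\<in>{0..T}.
          g (xs + s *\<^sub>R w) l \<le> g xs l + s * (D xs l0 \<bullet> w + (- (D xs l0 \<bullet> w)))"
        using directional_upper_bound[of "- (D xs l0 \<bullet> w)" xs w] by auto
      then have "g (xs + T *\<^sub>R w) l0 \<le> g xs l0"
        using eventually_nhds_x_imp_x[OF T(2)] by auto
      then show thesis using that[of T] T feas by auto
    qed
    have "t * (u \<bullet> w) \<le> 0" using normal[OF t(2)] by simp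
    then show ?thesis using t by (simp add: mult_le_0_iff)
  qed
  show thesis
  proof (cases "g xs l0 < 0")
    case True
    then have "u = 0" using dir[of u] by (metis inner_gt_zero_iff not_le)
    then show thesis using that[of 0] by simp
  next
    case False
    define d where "d = D xs l0"
    have act: "g xs l0 = 0" using False feas by simp
    then have d: "0 < d \<bullet> d" using active_gradient_nonzero by (simp add: d_def)
    define c where "c = (u \<bullet> d) / (d \<bullet> d)"
    define p where "p = u - c *\<^sub>R d"
    have pd: "p \<bullet> d = 0" using d by (simp add: p_def c_def inner_diff_left)
    have "u \<bullet> (- d) \<le> 0" using dir[of "- d"] d by (simp add: d_def)
    then have c: "0 \<le> c" using d by (simp add: c_def)
    \<comment> \<open>test with the tilted direction \<open>p - \<tau> *\<^sub>R d\<close>, then let \<open>\<tau>\<close> tend to 0\<close>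
    have le: "p \<bullet> p \<le> \<tau> * (u \<bullet> d)" if "0 < \<tau>" for \<tau>
    proof -
      have "d \<bullet> (p - \<tau> *\<^sub>R d) < 0"
        using pd d that by (simp add: inner_diff_right inner_commute)
      then have "u \<bullet> (p - \<tau> *\<^sub>R d) \<le> 0" using dir by (simp add: d_def)
      moreover have "u \<bullet> p = p \<bullet> p"
        using pd by (simp add: p_def inner_diff_left inner_diff_right inner_commute)
      ultimately show ?thesis by (simp add: inner_diff_right)
    qed
    have "p \<bullet> p \<le> 0"
    proof (rule field_le_epsilon)
      fix \<xi> :: real assume \<xi>: "0 < \<xi>"
      have "\<xi> / (\<bar>u \<bullet> d\<bar> + 1) * (u \<bullet> d) \<le> \<xi>"
        using \<xi> by (simp add: field_simps abs_if)
      then show "p \<bullet> p \<le> 0 + \<xi>" using le[of "\<xi> / (\<bar>u \<bullet> d\<bar> + 1)"] \<xi> by simp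
    qed
    then have "p = 0" by (metis inner_gt_zero_iff not_le)
    then have "u = c *\<^sub>R d" by (simp add: p_def)
    then show thesis using that c act by (simp add: d_def)
  qed
qed

end

section \<open>The distance of two parametric convex sets\<close>

locale convex_constraint_pair =
  G: convex_constraint g D l0 + H: convex_constraint h E m0
  for g :: "'a::euclidean_space \<Rightarrow> 'l::real_normed_vector \<Rightarrow> real" and D l0
    and h :: "'a \<Rightarrow> 'm::real_normed_vector \<Rightarrow> real" and E m0
begin

definition feasible :: "'l \<times> 'm \<Rightarrow> ('a \<times> 'a) set" where
  "feasible \<theta> = {x. g x (fst \<theta>) \<le> 0} \<times> {y. h y (snd \<theta>) \<le> 0}"

definition cost :: "'a \<times> 'a \<Rightarrow> real" where
  "cost z = 1/2 * (norm (fst z - snd z))\<^sup>2"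

definition val :: "'l \<times> 'm \<Rightarrow> real" where
  "val \<theta> = (LEAST v. v \<in> cost ` feasible \<theta>)"

definition minimizer :: "'l \<times> 'm \<Rightarrow> 'a \<times> 'a \<Rightarrow> bool" where
  "minimizer \<theta> z \<longleftrightarrow> z \<in> feasible \<theta> \<and> (\<forall>w\<in>feasible \<theta>. cost z \<le> cost w)"

lemma val_minimizer:
  assumes "minimizer \<theta> z" shows "val \<theta> = cost z"
  unfolding val_def using assms by (intro Least_equality) (auto simp: minimizer_def)

lemma continuous_cost: "continuous_on UNIV cost"
  unfolding cost_def by (intro continuous_intros)

lemma uniformly_bounded_pair:
  obtains R where "\<forall>\<^sub>F \<theta> in nhds (l0, m0). feasible \<theta> \<subseteq> cball 0 R \<times> cball 0 R"
proof -
  obtain R1 where R1: "\<forall>\<^sub>F l in nhds l0. {x. g x l \<le> 0} \<subseteq> cball 0 R1"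
    using G.uniformly_bounded_feasible by blast
  obtain R2 where R2: "\<forall>\<^sub>F m in nhds m0. {y. h y m \<le> 0} \<subseteq> cball 0 R2"
    using H.uniformly_bounded_feasible by blast
  have "\<forall>\<^sub>F \<theta> in nhds (l0, m0). {x. g x (fst \<theta>) \<le> 0} \<subseteq> cball 0 R1"
    "\<forall>\<^sub>F \<theta> in nhds (l0, m0). {y. h y (snd \<theta>) \<le> 0} \<subseteq> cball 0 R2"
    using eventually_nhds_fst[OF R1] eventually_nhds_snd[OF R2] by auto
  then have "\<forall>\<^sub>F \<theta> in nhds (l0, m0). feasible \<theta> \<subseteq> cball 0 (max R1 R2) \<times> cball 0 (max R1 R2)"
    by eventually_elim (force simp: feasible_def)
  then show thesis by (rule that)
qed

lemma minimizer_exists: "\<forall>\<^sub>F \<theta> in nhds (l0, m0). \<exists>z. minimizer \<theta> z"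
proof -
  obtain p where p: "g p l0 < 0" using G.Slater by blast
  obtain q where q: "h q m0 < 0" using H.Slater by blast
  have ne: "\<forall>\<^sub>F \<theta> in nhds (l0, m0). g p (fst \<theta>) < 0" "\<forall>\<^sub>F \<theta> in nhds (l0, m0). h q (snd \<theta>) < 0"
    using eventually_nhds_fst[OF order_tendstoD(2)[OF G.value_tendsto p]]
      eventually_nhds_snd[OF order_tendstoD(2)[OF H.value_tendsto q]] by auto
  obtain R where "\<forall>\<^sub>F \<theta> in nhds (l0, m0). feasible \<theta> \<subseteq> cball 0 R \<times> cball 0 R"
    using uniformly_bounded_pair by blast
  with ne show ?thesis
  proof eventually_elim
    case (elim \<theta>)
    have "closed (feasible \<theta>)"
      unfolding feasible_def by (intro closed_Times G.closed_feasible H.closed_feasible)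
    moreover have "bounded (feasible \<theta>)"
      using elim(3) by (rule bounded_subset[rotated]) (intro bounded_Times bounded_cball)
    moreover have "(p, q) \<in> feasible \<theta>" using elim(1,2) by (simp add: feasible_def)
    ultimately have "compact (feasible \<theta>)" "feasible \<theta> \<noteq> {}"
      by (auto simp: compact_eq_bounded_closed)
    from continuous_attains_inf[OF this continuous_on_subset[OF continuous_cost]]
    show ?case unfolding minimizer_def by blast
  qed
qed

text \<open>
  Each point of a closest pair is the projection of the other one, so their difference is a normal
  vector of both feasible sets. The multipliers are those of the Karush-Kuhn-Tucker conditions.
\<close>

lemma minimizer_multipliers:
  assumes min: "minimizer (l0, m0) (xs, ys)"
  obtains c k where "0 \<le> c" "ys - xs = c *\<^sub>R D xs l0" "c = 0 \<or> g xs l0 = 0"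
    and "0 \<le> k" "xs - ys = k *\<^sub>R E ys m0" "k = 0 \<or> h ys m0 = 0"
proof -
  have feas: "g xs l0 \<le> 0" "h ys m0 \<le> 0" using min by (auto simp: minimizer_def feasible_def)
  have cvx: "convex {x. g x l0 \<le> 0}" "convex {y. h y m0 \<le> 0}"
    using convex_sublevel[OF G.convex] convex_sublevel[OF H.convex] by auto
  have "(ys - xs) \<bullet> (x - xs) \<le> 0" if "g x l0 \<le> 0" for x
  proof (rule any_closest_point_dot[OF cvx(1) G.closed_feasible])
    show "\<forall>z\<in>{x. g x l0 \<le> 0}. dist ys xs \<le> dist ys z"
    proof
      fix z assume "z \<in> {x. g x l0 \<le> 0}"
      then have "cost (xs, ys) \<le> cost (z, ys)" using min by (auto simp: minimizer_def feasible_def)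
      then show "dist ys xs \<le> dist ys z"
        by (simp add: cost_def dist_norm norm_minus_commute)
    qed
  qed (use feas that in auto)
  then obtain c where c: "0 \<le> c" "ys - xs = c *\<^sub>R D xs l0" "c = 0 \<or> g xs l0 = 0"
    using G.normal_vector_multiplier[OF feas(1), of "ys - xs"] by metis
  have "(xs - ys) \<bullet> (y - ys) \<le> 0" if "h y m0 \<le> 0" for y
  proof (rule any_closest_point_dot[OF cvx(2) H.closed_feasible])
    show "\<forall>z\<in>{y. h y m0 \<le> 0}. dist xs ys \<le> dist xs z"
    proof
      fix z assume "z \<in> {y. h y m0 \<le> 0}"
      then have "cost (xs, ys) \<le> cost (xs, z)" using min by (auto simp: minimizer_def feasible_def)
      then show "dist xs ys \<le> dist xs z"
        by (simp add: cost_def dist_norm)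
    qed
  qed (use feas that in auto)
  then obtain k where k: "0 \<le> k" "xs - ys = k *\<^sub>R E ys m0" "k = 0 \<or> h ys m0 = 0"
    using H.normal_vector_multiplier[OF feas(2), of "xs - ys"] by metis
  show thesis using that c k by blast
qed

text \<open>
  The midpoints of two closest pairs form a closest pair again. If the pairs differed in one
  component, the midpoint there would be strictly feasible, its multiplier would vanish, and the
  distance would be zero.
\<close>

lemma minimizer_unique:
  assumes min: "minimizer (l0, m0) (x, y)" "minimizer (l0, m0) (x', y')"
    and ne: "x \<noteq> y"
  shows "x = x' \<and> y = y'"
proof -
  define a b where "a = midpoint x x'" and "b = midpoint y y'"
  have feas: "g x l0 \<le> 0" "h y m0 \<le> 0" "g x' l0 \<le> 0" "h y' m0 \<le> 0"
    using min by (auto simp: minimizer_def feasible_def)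
  have eq: "norm (x - y) = norm (x' - y')"
  proof -
    have "cost (x, y) = cost (x', y')" using val_minimizer min by metis
    then show ?thesis by (simp add: cost_def)
  qed
  have "g a l0 \<le> 0" "h b m0 \<le> 0"
    using G.strict_midpoint[of x x'] H.strict_midpoint[of y y'] feas
    by (cases "x = x'"; cases "y = y'"; simp add: a_def b_def)+
  moreover have "cost (a, b) \<le> cost (x, y)"
  proof -
    have "a - b = (1/2) *\<^sub>R (x - y) + (1/2) *\<^sub>R (x' - y')"
      by (simp add: a_def b_def midpoint_def algebra_simps)
    then have "norm (a - b) \<le> norm (x - y)"
      using norm_triangle_ineq[of "(1/2) *\<^sub>R (x - y)" "(1/2) *\<^sub>R (x' - y')"] eq by simp
    then show ?thesis by (simp add: cost_def)
  qed
  ultimately have mid: "minimizer (l0, m0) (a, b)"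
    using min(1) by (force simp: minimizer_def feasible_def)
  have "cost (a, b) = cost (x, y)" using val_minimizer mid min(1) by metis
  then have "norm (a - b) = norm (x - y)" by (simp add: cost_def)
  then have ab: "a \<noteq> b" using ne by auto
  obtain c k where "b - a = c *\<^sub>R D a l0" "c = 0 \<or> g a l0 = 0"
    "a - b = k *\<^sub>R E b m0" "k = 0 \<or> h b m0 = 0"
    using minimizer_multipliers[OF mid] by metis
  then have "g a l0 = 0" "h b m0 = 0" using ab by auto
  then show ?thesis
    using G.strict_midpoint[of x x'] H.strict_midpoint[of y y'] feas by (auto simp: a_def b_def)
qed

text \<open>
  A compactness argument: near a pair other than \<open>(xs, ys)\<close>, minimizers for nearby parameters are
  excluded because one of the two points is infeasible or the cost is too high. The last case needs
  upper semicontinuity of the value function.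
\<close>

lemma minimizers_converge:
  assumes min: "minimizer (l0, m0) (xs, ys)" and ne: "xs \<noteq> ys" and r: "0 < r"
    and usc: "\<And>e. 0 < e \<Longrightarrow> \<forall>\<^sub>F \<theta> in nhds (l0, m0). val \<theta> < val (l0, m0) + e"
  shows "\<forall>\<^sub>F \<theta> in nhds (l0, m0). \<forall>z. minimizer \<theta> z \<longrightarrow> dist z (xs, ys) < r"
proof -
  obtain R where R: "\<forall>\<^sub>F \<theta> in nhds (l0, m0). feasible \<theta> \<subseteq> cball 0 R \<times> cball 0 R"
    using uniformly_bounded_pair by blast
  define K where "K = (cball 0 R \<times> cball 0 R) - ball (xs, ys) r"
  have "compact K" unfolding K_def by (intro compact_diff compact_Times compact_cball open_ball)
  have "\<forall>\<^sub>F \<theta> in nhds (l0, m0). \<forall>z\<in>K. \<not> minimizer \<theta> z"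
  proof (rule eventually_ball_compact[OF \<open>compact K\<close>])
    fix q assume q: "q \<in> K"
    have fst: "(fst \<longlongrightarrow> (l0, m0)) (nhds ((l0, m0), q))"
      using tendsto_fst[OF filterlim_ident, of "((l0, m0), q)"] by simp
    have snd: "(snd \<longlongrightarrow> q) (nhds ((l0, m0), q))"
      using tendsto_snd[OF filterlim_ident, of "((l0, m0), q)"] by simp
    consider "g (fst q) l0 > 0" | "h (snd q) m0 > 0" | "q \<in> feasible (l0, m0)"
      by (force simp: feasible_def not_le mem_Times_iff)
    then show "\<forall>\<^sub>F (\<theta>, z) in nhds ((l0, m0), q). \<not> minimizer \<theta> z"
    proof cases
      case 1
      have "((\<lambda>w. (fst (fst w), fst (snd w))) \<longlongrightarrow> (l0, fst q)) (nhds ((l0, m0), q))"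
        using tendsto_fst[OF fst] tendsto_fst[OF snd] by (intro tendsto_Pair) auto
      from eventually_compose_filterlim[OF G.infeasible_nearby[OF 1] this]
      show ?thesis
        by eventually_elim (auto simp: minimizer_def feasible_def)
    next
      case 2
      have "((\<lambda>w. (snd (fst w), snd (snd w))) \<longlongrightarrow> (m0, snd q)) (nhds ((l0, m0), q))"
        using tendsto_snd[OF fst] tendsto_snd[OF snd] by (intro tendsto_Pair) auto
      from eventually_compose_filterlim[OF H.infeasible_nearby[OF 2] this]
      show ?thesis
        by eventually_elim (auto simp: minimizer_def feasible_def)
    next
      case 3
      have "q \<noteq> (xs, ys)" using q r by (auto simp: K_def)
      then have "\<not> minimizer (l0, m0) q"
        using minimizer_unique[OF min, of "fst q" "snd q"] ne by auto
      then obtain w where "w \<in> feasible (l0, m0)" "cost w < cost q"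
        using 3 by (auto simp: minimizer_def not_le)
      then have gap: "val (l0, m0) < cost q"
        using min val_minimizer[OF min] by (force simp: minimizer_def)
      define e where "e = (cost q - val (l0, m0)) / 2"
      have e: "0 < e" "val (l0, m0) + e < cost q" using gap by (auto simp: e_def field_simps)
      have "((\<lambda>w. cost (snd w)) \<longlongrightarrow> cost q) (nhds ((l0, m0), q))"
        by (rule continuous_on_tendsto_compose[OF continuous_cost snd]) auto
      from order_tendstoD(1)[OF this e(2)]
        eventually_compose_filterlim[OF usc[OF e(1)] fst]
      show ?thesis
        by eventually_elim (auto dest: val_minimizer)
    qed
  qed
  with R show ?thesis
    by eventually_elim (force simp: K_def minimizer_def dist_commute not_less)
qed

lemma cost_expansion:
  assumes "ys - xs = c *\<^sub>R u" "xs - ys = k *\<^sub>R w"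
  shows "cost (x, y) = cost (xs, ys) - c * (u \<bullet> (x - xs)) - k * (w \<bullet> (y - ys))
      + 1/2 * (norm ((x - xs) - (y - ys)))\<^sup>2"
proof -
  have "(ys - xs) \<bullet> (x - xs) = c * (u \<bullet> (x - xs))" "(xs - ys) \<bullet> (y - ys) = k * (w \<bullet> (y - ys))"
    using assms by auto
  then show ?thesis using half_sqnorm_expansion[of x y xs ys] by (simp add: cost_def)
qed

text \<open>
  The corrected points of \<open>feasible_correction\<close> form a competitor. The quadratic term of its cost is
  \<open>O((norm (\<theta> - (l0, m0)))\<^sup>2)\<close>, with a constant that does not depend on the margin \<open>\<delta>\<close>.
\<close>

lemma val_upper_bound:
  assumes min: "minimizer (l0, m0) (xs, ys)"
    and A: "(g xs has_derivative A) (at l0)" and B: "(h ys has_derivative B) (at m0)"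
    and c: "0 \<le> c" "ys - xs = c *\<^sub>R D xs l0" "c = 0 \<or> g xs l0 = 0"
    and k: "0 \<le> k" "xs - ys = k *\<^sub>R E ys m0" "k = 0 \<or> h ys m0 = 0"
    and e: "0 < e"
  shows "\<forall>\<^sub>F \<theta> in nhds (l0, m0). val \<theta> \<le> val (l0, m0)
      + (c * A (fst \<theta> - l0) + k * B (snd \<theta> - m0)) + e * norm (\<theta> - (l0, m0))"
proof -
  have feas: "g xs l0 \<le> 0" "h ys m0 \<le> 0" using min by (auto simp: minimizer_def feasible_def)
  define \<delta> where "\<delta> = min 1 (e / 2 / (c + k + 1))"
  have "0 < c + k + 1" using c k by simp
  then have "(c + k) * (e / 2 / (c + k + 1)) \<le> e / 2" using e by (simp add: field_simps)
  moreover have "(c + k) * \<delta> \<le> (c + k) * (e / 2 / (c + k + 1))"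
    using c k by (intro mult_left_mono) (auto simp: \<delta>_def)
  ultimately have "(c + k) * \<delta> \<le> e / 2" by (rule order_trans[rotated])
  moreover have "0 < \<delta>" "\<delta> \<le> 1" using e \<open>0 < c + k + 1\<close> by (auto simp: \<delta>_def)
  ultimately have \<delta>: "0 < \<delta>" "\<delta> \<le> 1" "(c + k) * \<delta> \<le> e / 2" by auto
  obtain K where K: "0 \<le> K" and "\<And>\<delta>. \<lbrakk>0 < \<delta>; \<delta> \<le> 1\<rbrakk> \<Longrightarrow>
      \<forall>\<^sub>F l in nhds l0. \<exists>x. g x l \<le> 0 \<and> norm (x - xs) \<le> K * norm (l - l0)
        \<and> (g xs l0 = 0 \<longrightarrow> - A (l - l0) - \<delta> * norm (l - l0) \<le> D xs l0 \<bullet> (x - xs))"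
    using G.feasible_correction[OF feas(1) A] by blast
  note G1 = this(2)[OF \<delta>(1,2)]
  obtain K' where K': "0 \<le> K'" and "\<And>\<delta>. \<lbrakk>0 < \<delta>; \<delta> \<le> 1\<rbrakk> \<Longrightarrow>
      \<forall>\<^sub>F m in nhds m0. \<exists>y. h y m \<le> 0 \<and> norm (y - ys) \<le> K' * norm (m - m0)
        \<and> (h ys m0 = 0 \<longrightarrow> - B (m - m0) - \<delta> * norm (m - m0) \<le> E ys m0 \<bullet> (y - ys))"
    using H.feasible_correction[OF feas(2) B] by blast
  note H1 = this(2)[OF \<delta>(1,2)]
  define Q where "Q = (K + K')\<^sup>2 + 1"
  have Q: "0 < Q" by (simp add: Q_def add_nonneg_pos)
  have near: "\<forall>\<^sub>F \<theta> in nhds (l0, m0). dist \<theta> (l0, m0) < e / Q"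
    using e Q unfolding eventually_nhds_metric by (intro exI[of _ "e / Q"]) auto
  show ?thesis
    using eventually_nhds_fst[OF G1]
      eventually_nhds_snd[OF H1] near minimizer_exists
  proof eventually_elim
    case (elim \<theta>)
    define N where "N = norm (\<theta> - (l0, m0))"
    have N: "0 \<le> N" "norm (fst \<theta> - l0) \<le> N" "norm (snd \<theta> - m0) \<le> N"
      using norm_fst_le[of "fst \<theta> - l0" "snd \<theta> - m0"] norm_snd_le[of "snd \<theta> - m0" "fst \<theta> - l0"]
      by (auto simp: N_def minus_prod_def)
    obtain x where x: "g x (fst \<theta>) \<le> 0" "norm (x - xs) \<le> K * norm (fst \<theta> - l0)"
      "g xs l0 = 0 \<longrightarrow> - A (fst \<theta> - l0) - \<delta> * norm (fst \<theta> - l0) \<le> D xs l0 \<bullet> (x - xs)"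
      using elim(1) by blast
    obtain y where y: "h y (snd \<theta>) \<le> 0" "norm (y - ys) \<le> K' * norm (snd \<theta> - m0)"
      "h ys m0 = 0 \<longrightarrow> - B (snd \<theta> - m0) - \<delta> * norm (snd \<theta> - m0) \<le> E ys m0 \<bullet> (y - ys)"
      using elim(2) by blast
    have cx: "- (c * (D xs l0 \<bullet> (x - xs))) \<le> c * A (fst \<theta> - l0) + c * \<delta> * N"
    proof (cases "c = 0")
      case False
      then have "- (D xs l0 \<bullet> (x - xs)) \<le> A (fst \<theta> - l0) + \<delta> * N"
        using x(3) c(3) False mult_left_mono[OF N(2) less_imp_le[OF \<delta>(1)]] by linarith
      from mult_left_mono[OF this c(1)] show ?thesis by (simp add: algebra_simps)
    qed simp
    have ky: "- (k * (E ys m0 \<bullet> (y - ys))) \<le> k * B (snd \<theta> - m0) + k * \<delta> * N"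
    proof (cases "k = 0")
      case False
      then have "- (E ys m0 \<bullet> (y - ys)) \<le> B (snd \<theta> - m0) + \<delta> * N"
        using y(3) k(3) False mult_left_mono[OF N(3) less_imp_le[OF \<delta>(1)]] by linarith
      from mult_left_mono[OF this k(1)] show ?thesis by (simp add: algebra_simps)
    qed simp
    have "norm ((x - xs) - (y - ys)) \<le> norm (x - xs) + norm (y - ys)" by (rule norm_triangle_ineq4)
    also have "\<dots> \<le> K * N + K' * N"
      using x(2) y(2) mult_left_mono[OF N(2) K] mult_left_mono[OF N(3) K'] by linarith
    finally have "norm ((x - xs) - (y - ys)) \<le> (K + K') * N" by (simp add: algebra_simps)
    then have "(norm ((x - xs) - (y - ys)))\<^sup>2 \<le> ((K + K') * N)\<^sup>2" by (simp add: power_mono)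
    also have "\<dots> = (K + K')\<^sup>2 * N * N" by (simp add: power2_eq_square)
    also have "\<dots> \<le> Q * N * N" using N(1) by (intro mult_right_mono) (auto simp: Q_def)
    also have "\<dots> \<le> e * N"
      using elim(3) Q N(1) by (intro mult_right_mono) (auto simp: N_def dist_norm field_simps)
    finally have sq: "(norm ((x - xs) - (y - ys)))\<^sup>2 \<le> e * N" .
    obtain z where z: "minimizer \<theta> z" using elim(4) by blast
    have "val \<theta> \<le> cost (x, y)"
      using val_minimizer[OF z] z x(1) y(1) by (simp add: minimizer_def feasible_def)
    also have "\<dots> = val (l0, m0) - c * (D xs l0 \<bullet> (x - xs)) - k * (E ys m0 \<bullet> (y - ys))
        + 1/2 * (norm ((x - xs) - (y - ys)))\<^sup>2"
      using cost_expansion[OF c(2) k(2), where x=x and y=y] val_minimizer[OF min] by simp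
    also have "\<dots> \<le> val (l0, m0) + (c * A (fst \<theta> - l0) + k * B (snd \<theta> - m0))
        + (c + k) * \<delta> * N + 1/2 * (e * N)"
      using cx ky sq by (simp add: algebra_simps)
    also have "\<dots> \<le> val (l0, m0) + (c * A (fst \<theta> - l0) + k * B (snd \<theta> - m0)) + e * N"
      using mult_right_mono[OF \<delta>(3) N(1)] by simp
    finally show ?case by (simp add: N_def)
  qed
qed

lemma val_upper_semicontinuous:
  assumes "0 < e"
  shows "\<forall>\<^sub>F \<theta> in nhds (l0, m0). val \<theta> < val (l0, m0) + e"
proof -
  obtain xs ys where min: "minimizer (l0, m0) (xs, ys)"
    using eventually_nhds_x_imp_x[OF minimizer_exists] by auto
  obtain A B where A: "(g xs has_derivative A) (at l0)" and B: "(h ys has_derivative B) (at m0)"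
    using G.value_differentiable[of xs] H.value_differentiable[of ys]
    unfolding differentiable_def by blast
  obtain c k where c: "0 \<le> c" "ys - xs = c *\<^sub>R D xs l0" "c = 0 \<or> g xs l0 = 0"
    and k: "0 \<le> k" "xs - ys = k *\<^sub>R E ys m0" "k = 0 \<or> h ys m0 = 0"
    using minimizer_multipliers[OF min] by blast
  define L where "L = (\<lambda>\<theta>. c * A (fst \<theta>) + k * B (snd \<theta>))"
  have "bounded_linear L"
    unfolding L_def using A B by (intro bounded_linear_multipliers has_derivative_bounded_linear)
  have shift: "((\<lambda>\<theta>. \<theta> - (l0, m0)) \<longlongrightarrow> 0) (nhds (l0, m0))"
    using tendsto_diff[OF filterlim_ident tendsto_const, of "(l0, m0)" "(l0, m0)"] by simp
  have "((\<lambda>\<theta>. L (\<theta> - (l0, m0)) + norm (\<theta> - (l0, m0))) \<longlongrightarrow> L 0 + norm (0 :: 'l \<times> 'm)) (nhds (l0, m0))"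
    by (rule tendsto_add[OF bounded_linear.tendsto[OF \<open>bounded_linear L\<close> shift] tendsto_norm[OF shift]])
  then have "\<forall>\<^sub>F \<theta> in nhds (l0, m0). L (\<theta> - (l0, m0)) + norm (\<theta> - (l0, m0)) < e"
    by (rule order_tendstoD(2)) (use assms linear_0[OF bounded_linear.linear[OF \<open>bounded_linear L\<close>]] in simp)
  with val_upper_bound[OF min A B c k zero_less_one] show ?thesis
    by eventually_elim (simp add: L_def)
qed

text \<open>
  The lower bound drops the quadratic term of the cost expansion at the minimizers for \<open>\<theta>\<close>.
\<close>

theorem val_differentiable: "val differentiable (at (l0, m0))"
proof -
  obtain xs ys where min: "minimizer (l0, m0) (xs, ys)"
    using eventually_nhds_x_imp_x[OF minimizer_exists] by auto
  obtain A B where A: "(g xs has_derivative A) (at l0)" and B: "(h ys has_derivative B) (at m0)"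
    using G.value_differentiable[of xs] H.value_differentiable[of ys]
    unfolding differentiable_def by blast
  obtain c k where c: "0 \<le> c" "ys - xs = c *\<^sub>R D xs l0" "c = 0 \<or> g xs l0 = 0"
    and k: "0 \<le> k" "xs - ys = k *\<^sub>R E ys m0" "k = 0 \<or> h ys m0 = 0"
    using minimizer_multipliers[OF min] by blast
  define L where "L = (\<lambda>\<theta>. c * A (fst \<theta>) + k * B (snd \<theta>))"
  have lower: "\<forall>\<^sub>F \<theta> in nhds (l0, m0).
      val (l0, m0) + L (\<theta> - (l0, m0)) - e * norm (\<theta> - (l0, m0)) \<le> val \<theta>" if e: "0 < e" for e
  proof (cases "xs = ys")
    case True
    then have "c = 0" "k = 0"
      using c k G.active_gradient_nonzero[of xs] H.active_gradient_nonzero[of ys] by auto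
    moreover have "val (l0, m0) = 0" using val_minimizer[OF min] True by (simp add: cost_def)
    ultimately have *: "val (l0, m0) + L (\<theta> - (l0, m0)) - e * norm (\<theta> - (l0, m0)) \<le> 0" for \<theta>
      using e by (simp add: L_def)
    have nonneg: "0 \<le> val \<theta>" if ex: "\<exists>z. minimizer \<theta> z" for \<theta>
    proof -
      obtain z where "minimizer \<theta> z" using ex by blast
      then have "val \<theta> = cost z" by (rule val_minimizer)
      also have "\<dots> \<ge> 0" by (simp add: cost_def)
      finally show ?thesis .
    qed
    show ?thesis using minimizer_exists
      by (rule eventually_mono) (rule order_trans[OF * nonneg])
  next
    case False
    have e2: "0 < e / 2" using e by simp
    obtain r1 where r1: "0 < r1" "\<forall>\<^sub>F l in nhds l0. \<forall>x. g x l \<le> 0 \<longrightarrow> norm (x - xs) \<le> r1 \<longrightarrow>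
        c * (D xs l0 \<bullet> (x - xs)) \<le> - (c * A (l - l0)) + e / 2 * norm (l - l0)"
      by (rule G.multiplier_first_order_bound[OF A c(1,3) e2])
    obtain r2 where r2: "0 < r2" "\<forall>\<^sub>F m in nhds m0. \<forall>y. h y m \<le> 0 \<longrightarrow> norm (y - ys) \<le> r2 \<longrightarrow>
        k * (E ys m0 \<bullet> (y - ys)) \<le> - (k * B (m - m0)) + e / 2 * norm (m - m0)"
      by (rule H.multiplier_first_order_bound[OF B k(1,3) e2])
    have "0 < min r1 r2" using r1 r2 by simp
    then have "\<forall>\<^sub>F \<theta> in nhds (l0, m0). \<forall>z. minimizer \<theta> z \<longrightarrow> dist z (xs, ys) < min r1 r2"
      by (rule minimizers_converge[OF min False]) (rule val_upper_semicontinuous)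
    from this minimizer_exists
      eventually_nhds_fst[OF r1(2)]
      eventually_nhds_snd[OF r2(2)]
    show ?thesis
    proof eventually_elim
      case (elim \<theta>)
      obtain x y where z: "minimizer \<theta> (x, y)" using elim(2) by auto
      then have feas: "g x (fst \<theta>) \<le> 0" "h y (snd \<theta>) \<le> 0"
        by (auto simp: minimizer_def feasible_def)
      have "norm ((x, y) - (xs, ys)) < min r1 r2" using elim(1) z by (simp add: dist_norm)
      then have "norm (x - xs) \<le> r1" "norm (y - ys) \<le> r2"
        using norm_fst_le[of "x - xs" "y - ys"] norm_snd_le[of "y - ys" "x - xs"] by auto
      then have
        "c * (D xs l0 \<bullet> (x - xs)) \<le> - (c * A (fst \<theta> - l0)) + e / 2 * norm (fst \<theta> - l0)"
        "k * (E ys m0 \<bullet> (y - ys)) \<le> - (k * B (snd \<theta> - m0)) + e / 2 * norm (snd \<theta> - m0)"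
        using elim(3,4) feas by blast+
      moreover have "e / 2 * norm (fst \<theta> - l0) \<le> e / 2 * norm (\<theta> - (l0, m0))"
        "e / 2 * norm (snd \<theta> - m0) \<le> e / 2 * norm (\<theta> - (l0, m0))"
        using norm_fst_le[of "fst \<theta> - l0" "snd \<theta> - m0"] norm_snd_le[of "snd \<theta> - m0" "fst \<theta> - l0"] e
        by (auto simp: minus_prod_def)
      moreover have "val \<theta> \<ge> val (l0, m0) - c * (D xs l0 \<bullet> (x - xs)) - k * (E ys m0 \<bullet> (y - ys))"
        using cost_expansion[OF c(2) k(2), where x=x and y=y] val_minimizer[OF min] val_minimizer[OF z] by simp
      ultimately show ?case by (simp add: L_def)
    qed
  qed
  have "(val has_derivative L) (at (l0, m0))"
    unfolding has_derivative_at_alt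
  proof (intro conjI allI impI)
    show "bounded_linear L"
      unfolding L_def using A B by (intro bounded_linear_multipliers has_derivative_bounded_linear)
    fix e :: real assume e: "0 < e"
    have "\<forall>\<^sub>F \<theta> in nhds (l0, m0).
        norm (val \<theta> - val (l0, m0) - L (\<theta> - (l0, m0))) \<le> e * norm (\<theta> - (l0, m0))"
      using lower[OF e] val_upper_bound[OF min A B c k e]
      by eventually_elim (simp add: L_def abs_le_iff)
    then show "\<exists>d>0. \<forall>\<theta>. norm (\<theta> - (l0, m0)) < d \<longrightarrow>
        norm (val \<theta> - val (l0, m0) - L (\<theta> - (l0, m0))) \<le> e * norm (\<theta> - (l0, m0))"
      unfolding eventually_nhds_metric dist_norm .
  qed
  then show ?thesis by (auto simp: differentiable_def)
qed

end

section \<open>The log-sum-exp overapproximation\<close>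

text \<open>
  \<open>LSE_plus \<epsilon> (F x l) \<le> ln n / \<epsilon>\<close> with the logarithm removed, where \<open>n\<close> is the number of components.
\<close>

definition exp_excess ::
  "real \<Rightarrow> (real^'n \<Rightarrow> real^'m \<Rightarrow> real^'k) \<Rightarrow> real^'n \<Rightarrow> real^'m \<Rightarrow> real" where
  "exp_excess \<epsilon> F x l = (\<Sum>k\<in>UNIV. exp (\<epsilon> * F x l $ k)) - (real CARD('k) - 1)"

definition exp_excess_grad ::
  "real \<Rightarrow> (real^'n \<Rightarrow> real^'m \<Rightarrow> real^'k) \<Rightarrow> real^'n \<Rightarrow> real^'m \<Rightarrow> real^'n" where
  "exp_excess_grad \<epsilon> F x l = (\<Sum>k\<in>UNIV. (exp (\<epsilon> * F x l $ k) * \<epsilon>) *\<^sub>R row k (jac_x F x l))"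

lemma overapprox_eq_exp_excess:
  assumes "\<epsilon> > 0"
  shows "overapprox \<epsilon> F l = {x. exp_excess \<epsilon> F x l \<le> 0}"
proof -
  have "LSE_plus \<epsilon> (F x l) \<le> ln (real CARD('c)) / \<epsilon> \<longleftrightarrow> exp_excess \<epsilon> F x l \<le> 0" for x
  proof -
    have pos: "0 < 1 + (\<Sum>k\<in>UNIV. exp (\<epsilon> * F x l $ k))"
      by (intro add_pos_nonneg sum_nonneg) auto
    have "LSE_plus \<epsilon> (F x l) \<le> ln (real CARD('c)) / \<epsilon> \<longleftrightarrow>
        ln (1 + (\<Sum>k\<in>UNIV. exp (\<epsilon> * F x l $ k))) \<le> ln (real CARD('c))"
      using assms by (simp add: LSE_plus_def divide_le_cancel)
    also have "\<dots> \<longleftrightarrow> 1 + (\<Sum>k\<in>UNIV. exp (\<epsilon> * F x l $ k)) \<le> real CARD('c)"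
      using pos by (intro ln_le_cancel_iff) (auto simp: zero_less_card_finite)
    finally show ?thesis by (auto simp: exp_excess_def)
  qed
  then show ?thesis by (simp add: overapprox_def)
qed

lemma component_has_derivative:
  fixes F :: "real^'n \<Rightarrow> real^'m \<Rightarrow> real^'k"
  assumes "(\<lambda>y. F y l) differentiable (at x)"
  shows "((\<lambda>y. F y l $ k) has_derivative (\<lambda>h. row k (jac_x F x l) \<bullet> h)) (at x)"
proof -
  have "((\<lambda>y. F y l) has_derivative (\<lambda>h. jac_x F x l *v h)) (at x)"
    using assms jacobian_works by (auto simp: jac_x_def)
  then have "((\<lambda>y. F y l $ k) has_derivative (\<lambda>h. (jac_x F x l *v h) $ k)) (at x)"
    by (rule bounded_linear.has_derivative[OF bounded_linear_vec_nth])
  then show ?thesis by (simp add: matrix_vector_mul_component row_def vec_lambda_eta)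
qed

lemma midpoint_component_bound:
  fixes f :: "real^'n \<Rightarrow> real"
  assumes "convex_on UNIV f"
  shows "f (midpoint x y) \<le> (f x + f y) / 2"
  using convex_onD[OF assms, of "1/2" x y] by (simp add: midpoint_def scaleR_add_right)

text \<open>
  Strict convexity of the exponential function, in the form needed for \<open>exp \<circ> f\<close> with \<open>f\<close> convex:
  the midpoint inequality is an equality only if \<open>f\<close> takes equal values at both ends and at the
  midpoint. The inequality is that of the arithmetic and geometric means of \<open>exp a\<close> and \<open>exp b\<close>.
\<close>

lemma exp_midpoint:
  fixes a b c :: real
  assumes "c \<le> (a + b) / 2"
  shows "exp c \<le> (exp a + exp b) / 2"
    and "exp c = (exp a + exp b) / 2 \<Longrightarrow> a = b \<and> c = a"
proof -
  define p q where "p = exp (a / 2)" and "q = exp (b / 2)"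
  have p: "exp a = p\<^sup>2" "exp b = q\<^sup>2" "exp ((a + b) / 2) = p * q"
    by (auto simp: p_def q_def power2_eq_square field_simps simp flip: exp_add)
  have le: "exp c \<le> p * q" using assms p by (metis exp_le_cancel_iff)
  have sq: "(p\<^sup>2 + q\<^sup>2) / 2 - p * q = (p - q)\<^sup>2 / 2" by (simp add: power2_eq_square field_simps)
  have "p * q \<le> (p\<^sup>2 + q\<^sup>2) / 2" using sq zero_le_power2[of "p - q"] by linarith
  then show "exp c \<le> (exp a + exp b) / 2" using le unfolding p by linarith
  assume eq: "exp c = (exp a + exp b) / 2"
  then have "(p - q)\<^sup>2 \<le> 0" using sq le unfolding p by linarith
  then have "p = q" by simp
  then have "a = b" by (simp add: p_def q_def)
  then show "a = b \<and> c = a" using eq by simp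
qed

text \<open>
  The rank condition enters through strict midpoint convexity, and the nonempty interior through the
  Slater point: it contains two distinct points, whose midpoint is strictly feasible. Boundedness
  comes from \<open>S l0\<close>, which is the zero sublevel set of the sum \<open>\<psi>\<close> of the positive parts of the
  components; \<open>\<psi>\<close> is bounded on the overapproximation.
\<close>

lemma convex_constraint_exp_excess:
  fixes F :: "real^'n \<Rightarrow> real^'m \<Rightarrow> real^'k"
  assumes \<epsilon>: "\<epsilon> > 0" and std: "standard_conditions S F"
    and rank: "\<And>x. rank (jac_x F x l0) = CARD('n)"
    and param: "\<And>x. (\<lambda>l. F x l) differentiable (at l0)"
    and int: "interior (overapprox \<epsilon> F l0) \<noteq> {}"
  shows "convex_constraint (exp_excess \<epsilon> F) (exp_excess_grad \<epsilon> F) l0"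
proof -
  have cvx: "convex_on UNIV (\<lambda>x. F x l $ k)" for l k
    using std by (simp add: standard_conditions_def)
  have der: "((\<lambda>y. F y l $ k) has_derivative (\<lambda>h. row k (jac_x F x l) \<bullet> h)) (at x)" for x l k
    using std by (intro component_has_derivative) (simp add: standard_conditions_def)
  have tangent: "F x l $ k + row k (jac_x F x l) \<bullet> (y - x) \<le> F y l $ k" for x y l k
    by (rule convex_on_above_derivative[OF cvx der])
  have jac_param: "(\<lambda>l. row k (jac_x F x l)) differentiable (at l0)" for x k
    using std by (force simp: standard_conditions_def cont_diff_def differentiable_def)
  have exp_param: "(\<lambda>l. exp (\<epsilon> * F x l $ k)) differentiable (at l0)" for x k
  proof -
    obtain A where "(F x has_derivative A) (at l0)"
      using param by (auto simp: differentiable_def)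
    then have "((\<lambda>l. F x l $ k) has_derivative (\<lambda>h. A h $ k)) (at l0)"
      by (rule bounded_linear.has_derivative[OF bounded_linear_vec_nth])
    from has_derivative_exp[OF has_derivative_mult_right[OF this, of \<epsilon>]]
    show ?thesis unfolding differentiable_def by blast
  qed
  have strict: "exp_excess \<epsilon> F (midpoint x y) l0 < 0"
    if ne: "x \<noteq> y" and le: "exp_excess \<epsilon> F x l0 \<le> 0" "exp_excess \<epsilon> F y l0 \<le> 0" for x y
  proof -
    let ?z = "midpoint x y"
    let ?mean = "\<lambda>k. (exp (\<epsilon> * F x l0 $ k) + exp (\<epsilon> * F y l0 $ k)) / 2"
    have mid: "\<epsilon> * F ?z l0 $ k \<le> (\<epsilon> * F x l0 $ k + \<epsilon> * F y l0 $ k) / 2" for k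
      using mult_left_mono[OF midpoint_component_bound[OF cvx[of l0 k], of x y], of \<epsilon>] \<epsilon>
      by (simp add: algebra_simps)
    have "\<exists>k. exp (\<epsilon> * F ?z l0 $ k) < ?mean k"
    proof (rule ccontr)
      assume "\<not> ?thesis"
      then have "exp (\<epsilon> * F ?z l0 $ k) = ?mean k" for k
        using exp_midpoint(1)[OF mid] by (force simp: not_less intro: antisym)
      then have eq: "F x l0 $ k = F ?z l0 $ k" "F y l0 $ k = F ?z l0 $ k" for k
        using exp_midpoint(2)[OF mid[of k]] \<epsilon> by auto
      \<comment> \<open>the tangents at the midpoint lie below \<open>F\<close> at both ends, which have opposite displacements\<close>
      have "row k (jac_x F ?z l0) \<bullet> (y - x) = 0" for k
      proof -
        have "row k (jac_x F ?z l0) \<bullet> (x - ?z) \<le> 0" "row k (jac_x F ?z l0) \<bullet> (y - ?z) \<le> 0"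
          using tangent[of ?z l0 k x] tangent[of ?z l0 k y] eq[of k] by auto
        moreover have "x - ?z = - ((1/2) *\<^sub>R (y - x))" "y - ?z = (1/2) *\<^sub>R (y - x)"
          by (simp_all add: midpoint_def vec_eq_iff field_simps)
        ultimately show ?thesis by simp
      qed
      then have "jac_x F ?z l0 *v (y - x) = jac_x F ?z l0 *v 0"
        by (simp add: vec_eq_iff matrix_vector_mul_component row_def vec_lambda_eta)
      then show False using rank full_rank_injective ne by (metis injD right_minus_eq)
    qed
    then obtain k where "exp (\<epsilon> * F ?z l0 $ k) < ?mean k" by blast
    then have "(\<Sum>k\<in>UNIV. exp (\<epsilon> * F ?z l0 $ k)) < (\<Sum>k\<in>UNIV. ?mean k)"
      using exp_midpoint(1)[OF mid] by (intro sum_strict_mono_ex1) auto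
    also have "\<dots> = ((\<Sum>k\<in>UNIV. exp (\<epsilon> * F x l0 $ k)) + (\<Sum>k\<in>UNIV. exp (\<epsilon> * F y l0 $ k))) / 2"
      by (simp add: sum.distrib flip: sum_divide_distrib)
    finally show ?thesis using le by (simp add: exp_excess_def)
  qed
  show ?thesis
  proof
    fix x y l
    have "exp_excess \<epsilon> F x l + exp_excess_grad \<epsilon> F x l \<bullet> (y - x)
      = (\<Sum>k\<in>UNIV. exp (\<epsilon> * F x l $ k) * (1 + \<epsilon> * (row k (jac_x F x l) \<bullet> (y - x)))) - (real CARD('k) - 1)"
      by (simp add: exp_excess_def exp_excess_grad_def inner_sum_left distrib_left sum.distrib mult.assoc)
    also have "\<dots> \<le> (\<Sum>k\<in>UNIV. exp (\<epsilon> * F y l $ k)) - (real CARD('k) - 1)"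
    proof (intro diff_right_mono sum_mono)
      fix k
      have "1 + \<epsilon> * (row k (jac_x F x l) \<bullet> (y - x)) \<le> 1 + \<epsilon> * (F y l $ k - F x l $ k)"
        using tangent[of x l k y] \<epsilon> by simp
      also have "\<dots> \<le> exp (\<epsilon> * (F y l $ k - F x l $ k))" by (rule exp_ge_add_one_self)
      finally have "exp (\<epsilon> * F x l $ k) * (1 + \<epsilon> * (row k (jac_x F x l) \<bullet> (y - x)))
        \<le> exp (\<epsilon> * F x l $ k) * exp (\<epsilon> * (F y l $ k - F x l $ k))" by simp
      also have "\<dots> = exp (\<epsilon> * F y l $ k)" by (simp add: algebra_simps flip: exp_add)
      finally show "exp (\<epsilon> * F x l $ k) * (1 + \<epsilon> * (row k (jac_x F x l) \<bullet> (y - x))) \<le> exp (\<epsilon> * F y l $ k)" .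
    qed
    finally show "exp_excess \<epsilon> F x l + exp_excess_grad \<epsilon> F x l \<bullet> (y - x) \<le> exp_excess \<epsilon> F y l"
      by (simp add: exp_excess_def)
  next
    fix x
    show "((\<lambda>x. exp_excess \<epsilon> F x l0) has_derivative (\<lambda>h. exp_excess_grad \<epsilon> F x l0 \<bullet> h)) (at x)"
      unfolding exp_excess_def exp_excess_grad_def
      by (auto intro!: derivative_eq_intros der sum.cong simp: inner_sum_left fun_eq_iff)
    show "exp_excess \<epsilon> F x differentiable (at l0)"
      unfolding exp_excess_def
      by (intro differentiable_diff differentiable_sum differentiable_const exp_param ballI) auto
    show "exp_excess_grad \<epsilon> F x differentiable (at l0)"
      unfolding exp_excess_grad_def
      by (intro differentiable_sum differentiable_scaleR differentiable_mult differentiable_const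
          exp_param jac_param ballI) auto
  next
    obtain c where c: "c \<in> interior {x. exp_excess \<epsilon> F x l0 \<le> 0}"
      using int overapprox_eq_exp_excess[OF \<epsilon>, of F l0] by auto
    then obtain r where r: "0 < r" "ball c r \<subseteq> {x. exp_excess \<epsilon> F x l0 \<le> 0}"
      by (auto simp: mem_interior)
    obtain d where d: "d \<in> ball c r" "d \<noteq> c"
    proof -
      obtain b :: "real^'n" where "norm b = r / 2" using vector_choose_size[of "r/2"] r by auto
      then show thesis using that[of "c + b"] r by (auto simp: dist_norm)
    qed
    have "d \<in> {x. exp_excess \<epsilon> F x l0 \<le> 0}" "c \<in> {x. exp_excess \<epsilon> F x l0 \<le> 0}"
      using subsetD[OF r(2)] d(1) r(1) by auto
    then have "exp_excess \<epsilon> F (midpoint d c) l0 < 0" using strict[OF d(2)] by simp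
    then show "\<exists>p. exp_excess \<epsilon> F p l0 < 0" by blast
  next
    define \<psi> where "\<psi> = (\<lambda>x. \<Sum>k\<in>UNIV. max 0 (F x l0 $ k))"
    have "convex_on UNIV \<psi>"
    proof (rule convex_onI)
      fix t :: real and x y :: "real^'n" assume t: "0 < t" "t < 1"
      have "max 0 (F ((1 - t) *\<^sub>R x + t *\<^sub>R y) l0 $ k)
        \<le> (1 - t) * max 0 (F x l0 $ k) + t * max 0 (F y l0 $ k)" for k
      proof (rule max.boundedI)
        show "0 \<le> (1 - t) * max 0 (F x l0 $ k) + t * max 0 (F y l0 $ k)" using t by simp
        have "F ((1 - t) *\<^sub>R x + t *\<^sub>R y) l0 $ k \<le> (1 - t) * F x l0 $ k + t * F y l0 $ k"
          using convex_onD[OF cvx, of t] t by simp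
        also have "\<dots> \<le> (1 - t) * max 0 (F x l0 $ k) + t * max 0 (F y l0 $ k)"
          using t by (intro add_mono mult_left_mono) auto
        finally show "F ((1 - t) *\<^sub>R x + t *\<^sub>R y) l0 $ k
          \<le> (1 - t) * max 0 (F x l0 $ k) + t * max 0 (F y l0 $ k)" .
      qed
      then show "\<psi> ((1 - t) *\<^sub>R x + t *\<^sub>R y) \<le> (1 - t) * \<psi> x + t * \<psi> y"
        unfolding \<psi>_def sum_distrib_left sum.distrib[symmetric] by (intro sum_mono)
    qed simp
    moreover have S: "{x. \<psi> x \<le> 0} = S l0"
    proof -
      have "\<psi> x \<le> 0 \<longleftrightarrow> (\<forall>k. F x l0 $ k \<le> 0)" for x
      proof -
        have "\<psi> x \<ge> 0" by (auto simp: \<psi>_def intro: sum_nonneg)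
        then have "\<psi> x \<le> 0 \<longleftrightarrow> \<psi> x = 0" by linarith
        also have "\<dots> \<longleftrightarrow> (\<forall>k. F x l0 $ k \<le> 0)"
          unfolding \<psi>_def by (subst sum_nonneg_eq_0_iff) (auto simp flip: max.absorb_iff1)
        finally show ?thesis .
      qed
      then show ?thesis using std by (simp add: standard_conditions_def)
    qed
    moreover have "bounded (S l0)" "interior (S l0) \<noteq> {}"
      using std by (auto simp: standard_conditions_def compact_imp_bounded)
    moreover from this obtain p where "p \<in> S l0" using interior_subset by blast
    ultimately have bdd: "bounded {x. \<psi> x \<le> real CARD('k) * (real CARD('k) / \<epsilon>)}"
      using bounded_sublevel_convex[of \<psi> p] by (metis mem_Collect_eq)
    have "{x. exp_excess \<epsilon> F x l0 \<le> 0} \<subseteq> {x. \<psi> x \<le> real CARD('k) * (real CARD('k) / \<epsilon>)}"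
    proof clarify
      fix x assume x: "exp_excess \<epsilon> F x l0 \<le> 0"
      have "max 0 (F x l0 $ k) \<le> real CARD('k) / \<epsilon>" for k
      proof -
        have "1 + \<epsilon> * F x l0 $ k \<le> exp (\<epsilon> * F x l0 $ k)" by (rule exp_ge_add_one_self)
        also have "\<dots> \<le> (\<Sum>k\<in>UNIV. exp (\<epsilon> * F x l0 $ k))" by (rule member_le_sum) auto
        also have "\<dots> \<le> real CARD('k) - 1" using x by (simp add: exp_excess_def)
        finally have "\<epsilon> * F x l0 $ k \<le> real CARD('k)" by simp
        then show ?thesis using \<epsilon> by (simp add: field_simps)
      qed
      then show "\<psi> x \<le> real CARD('k) * (real CARD('k) / \<epsilon>)"
        unfolding \<psi>_def by (rule sum_bounded_above)
    qed
    then show "bounded {x. exp_excess \<epsilon> F x l0 \<le> 0}" using bdd bounded_subset by blast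
  qed (rule strict)
qed

theorem corollary1:
  fixes S\<^sub>E :: "real^'mE \<Rightarrow> (real^'n) set"
    and S\<^sub>j :: "real^'mj \<Rightarrow> (real^'n) set"
    and F\<^sub>E :: "real^'n \<Rightarrow> real^'mE \<Rightarrow> real^'kE"
    and F\<^sub>j :: "real^'n \<Rightarrow> real^'mj \<Rightarrow> real^'kj"
    and l\<^sub>E :: "real^'mE"
    and l\<^sub>j :: "real^'mj"
    and \<epsilon> :: real
  assumes "\<epsilon> > 0"
    and "standard_conditions S\<^sub>E F\<^sub>E"
    and "standard_conditions S\<^sub>j F\<^sub>j"
    and "\<And>x l. rank (jac_x F\<^sub>E x l) = CARD('n)"
    and "\<And>x l. rank (jac_x F\<^sub>j x l) = CARD('n)"
    and "S\<^sub>E l\<^sub>E \<inter> S\<^sub>j l\<^sub>j = {}"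
    and diff_param_E: "\<And>x. (\<lambda>l. F\<^sub>E x l) differentiable (at l\<^sub>E)"
    and diff_param_j: "\<And>x. (\<lambda>l. F\<^sub>j x l) differentiable (at l\<^sub>j)"
    and interior_E: "interior (overapprox \<epsilon> F\<^sub>E l\<^sub>E) \<noteq> {}"
    and interior_j: "interior (overapprox \<epsilon> F\<^sub>j l\<^sub>j) \<noteq> {}"
  shows "(\<lambda>\<theta>. approx_sqdist \<epsilon> F\<^sub>E F\<^sub>j (fst \<theta>) (snd \<theta>)) differentiable (at (l\<^sub>E, l\<^sub>j))"
proof -
  interpret convex_constraint_pair
    "exp_excess \<epsilon> F\<^sub>E" "exp_excess_grad \<epsilon> F\<^sub>E" l\<^sub>E
    "exp_excess \<epsilon> F\<^sub>j" "exp_excess_grad \<epsilon> F\<^sub>j" l\<^sub>j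
    using convex_constraint_exp_excess[OF assms(1,2) assms(4) diff_param_E interior_E]
      convex_constraint_exp_excess[OF assms(1,3) assms(5) diff_param_j interior_j]
    by (rule convex_constraint_pair.intro)
  have "cost ` feasible \<theta> = {1/2 * (norm (z - w))\<^sup>2 | z w.
      z \<in> overapprox \<epsilon> F\<^sub>E (fst \<theta>) \<and> w \<in> overapprox \<epsilon> F\<^sub>j (snd \<theta>)}" for \<theta>
    by (force simp: overapprox_eq_exp_excess[OF assms(1)] feasible_def cost_def image_iff)
  then have "(\<lambda>\<theta>. approx_sqdist \<epsilon> F\<^sub>E F\<^sub>j (fst \<theta>) (snd \<theta>)) = val"
    by (intro ext) (simp only: approx_sqdist_def val_def)
  then show ?thesis using val_differentiable by simp
qed

end
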